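(* Let $(R,\mathfrak m)$ be a regular local ring with $\dim R=3$ and let $I$ be an ideal of $R$ such that $I^{n+1}:I=I^n$ for all $n\geq 1$. Then $\operatorname{depth}R/I^{n+1}\leq \operatorname{depth}R/I^n$ for all $n\geq 1$, i.e. the function $n\mapsto \operatorname{depth} R/I^n$ is non-increasing. *)

theory Defs
  imports "HOL-Algebra.Ideal_Product" "HOL-Algebra.Ring_Divisibility" "HOL-Library.Extended_Nat"
begin

primrec ideal_pow :: "('a, 'b) ring_scheme \<Rightarrow> 'a set \<Rightarrow> nat \<Rightarrow> 'a set" where
  "ideal_pow R I 0 = carrier R"
| "ideal_pow R I (Suc n) = ideal_prod R I (ideal_pow R I n)"

definition ideal_colon :: "('a, 'b) ring_scheme \<Rightarrow> 'a set \<Rightarrow> 'a set \<Rightarrow> 'a set" where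
  "ideal_colon R J K = {x \<in> carrier R. \<forall>a\<in>K. x \<otimes>\<^bsub>R\<^esub> a \<in> J}"

definition krull_dim :: "('a, 'b) ring_scheme \<Rightarrow> enat" where
  "krull_dim R = Sup {enat n | n. \<exists>P :: nat \<Rightarrow> 'a set.
      (\<forall>i\<le>n. primeideal (P i) R) \<and> (\<forall>i<n. P i \<subset> P (Suc i))}"

definition local_ring :: "('a, 'b) ring_scheme \<Rightarrow> 'a set \<Rightarrow> bool" where
  "local_ring R m \<longleftrightarrow> cring R \<and> maximalideal m R \<and> (\<forall>J. maximalideal J R \<longrightarrow> J = m)"

definition regular_local_ring :: "('a, 'b) ring_scheme \<Rightarrow> 'a set \<Rightarrow> bool" where
  "regular_local_ring R m \<longleftrightarrow> noetherian_ring R \<and> local_ring R m \<and>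
     (\<exists>S. finite S \<and> S \<subseteq> carrier R \<and> m = genideal R S \<and> enat (card S) = krull_dim R)"

definition quot_regular_seq :: "('a, 'b) ring_scheme \<Rightarrow> 'a set \<Rightarrow> 'a set \<Rightarrow> 'a list \<Rightarrow> bool" where
  "quot_regular_seq R m J xs \<longleftrightarrow> set xs \<subseteq> m \<and>
     (\<forall>i<length xs. \<forall>y\<in>carrier R.
        xs ! i \<otimes>\<^bsub>R\<^esub> y \<in> J <+>\<^bsub>R\<^esub> genideal R (set (take i xs)) \<longrightarrow>
        y \<in> J <+>\<^bsub>R\<^esub> genideal R (set (take i xs))) \<and>
     J <+>\<^bsub>R\<^esub> genideal R (set xs) \<noteq> carrier R"

text \<open>depth of R/J (w.r.t. m): supremum of lengths of R/J-regular sequences in m;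
  infinity for the zero module (J = R), by the usual convention.\<close>
definition depth_quot :: "('a, 'b) ring_scheme \<Rightarrow> 'a set \<Rightarrow> 'a set \<Rightarrow> enat" where
  "depth_quot R m J = (if J = carrier R then \<infinity>
      else Sup {enat (length xs) | xs. quot_regular_seq R m J xs})"

end

theory Submission
  imports Defs
begin

text \<open>Write \<open>m = (s, t, u)\<close>. Krull's principal ideal theorem, applied along a chain of four primes,
  produces primes that Nakayama's lemma identifies with \<open>0\<close>, \<open>(s)\<close> and \<open>(s, t)\<close>; so \<open>R\<close> is a domain
  and the Koszul complex of \<open>s, t, u\<close> is exact. All depth statements are then read off elementwise
  from Koszul homology. Suppose \<open>R/I\<^sup>n\<^sup>+\<^sup>1\<close> has a regular sequence of length \<open>k\<close>. If \<open>k = 3\<close>, then \<open>I\<^sup>n\<^sup>+\<^sup>1 = 0\<close>,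
  which the hypothesis excludes. If \<open>k = 2\<close>, then \<open>I\<^sup>n\<^sup>+\<^sup>1\<close> is principal, hence so is its factor \<open>I\<^sup>n\<close>,
  and \<open>R/I\<^sup>n\<close> has depth at least two. If \<open>k = 1\<close>, a socle element \<open>z\<close> of \<open>R/I\<^sup>n\<close> gives
  socle elements \<open>za\<close>, \<open>a \<in> I\<close>, of \<open>R/I\<^sup>n\<^sup>+\<^sup>1\<close>; these vanish, so \<open>z \<in> I\<^sup>n\<^sup>+\<^sup>1 : I = I\<^sup>n\<close>, and prime avoidance
  yields a regular element.\<close>

section \<open>Saturated ideals and the principal ideal theorem\<close>

text \<open>Regularity is given only as an equality between a number of generators and the Krull
  dimension, so every structural fact has to be extracted from \<open>s, t, u\<close> and a chain of
  primes. Neither localizations nor quotients are formed: ideals of the localization at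
  \<open>T\<close> appear as \<open>T\<close>-saturated ideals of \<open>R\<close>, and computing in
  \<open>R/J\<close> becomes membership in \<open>J\<close>. Depth is a supremum over arbitrary
  sequences in \<open>m\<close>, whereas Koszul cycles refer to the fixed generators. The link is
  that every \<open>x \<in> m\<close> annihilates Koszul homology through an explicit homotopy,
  built from the coefficients of \<open>x\<close> in \<open>s, t, u\<close>. The way back, from
  vanishing homology to a regular element, leads through associated primes. Depth two forces
  principality because Koszul homology of \<open>R/J\<close> is Tor with the residue field: if its
  second group vanishes, \<open>J\<close> has no minimal relations, so it is free, and in a domain
  it then has at most one generator. This replaces the Auslander-Buchsbaum formula. Principality
  descends from a product to its factors because \<open>R\<close> is a local domain.\<close>

locale noetherian_cring = noetherian_ring + cring

definition nonzerodivisor_mod :: "('a, 'b) ring_scheme \<Rightarrow> 'a set \<Rightarrow> 'a \<Rightarrow> bool" where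
  "nonzerodivisor_mod R J x \<longleftrightarrow> (\<forall>y\<in>carrier R. x \<otimes>\<^bsub>R\<^esub> y \<in> J \<longrightarrow> y \<in> J)"

text \<open>For prime \<open>T\<close> this says that \<open>J\<close> is the contraction of its
  extension to the localization at \<open>T\<close>, so that ideals of the localization can be
  handled without fractions.\<close>

definition saturated_at :: "('a, 'b) ring_scheme \<Rightarrow> 'a set \<Rightarrow> 'a set \<Rightarrow> bool" where
  "saturated_at R T J \<longleftrightarrow> (\<forall>c\<in>carrier R - T. nonzerodivisor_mod R J c)"

text \<open>The contraction to \<open>R\<close> of the ideal generated by \<open>J\<close> and
  \<open>z\<close> in the localization at \<open>T\<close>; the fraction \<open>d/c\<close> is the
  coefficient of \<open>z\<close>.\<close>

definition saturated_insert :: "('a, 'b) ring_scheme \<Rightarrow> 'a set \<Rightarrow> 'a set \<Rightarrow> 'a \<Rightarrow> 'a set" where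
  "saturated_insert R T J z =
     {r \<in> carrier R. \<exists>c\<in>carrier R - T. \<exists>d\<in>carrier R. c \<otimes>\<^bsub>R\<^esub> r \<ominus>\<^bsub>R\<^esub> d \<otimes>\<^bsub>R\<^esub> z \<in> J}"

lemma saturated_atD:
  "saturated_at R T J \<Longrightarrow> c \<in> carrier R \<Longrightarrow> c \<notin> T \<Longrightarrow> r \<in> carrier R \<Longrightarrow> c \<otimes>\<^bsub>R\<^esub> r \<in> J \<Longrightarrow> r \<in> J"
  by (auto simp: saturated_at_def nonzerodivisor_mod_def)

lemma nonzerodivisor_modD:
  "nonzerodivisor_mod R J x \<Longrightarrow> y \<in> carrier R \<Longrightarrow> x \<otimes>\<^bsub>R\<^esub> y \<in> J \<Longrightarrow> y \<in> J"
  by (auto simp: nonzerodivisor_mod_def)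

section \<open>Ideal arithmetic, colon ideals and saturation\<close>

context cring
begin

lemma ideal_carrier: "ideal J R \<Longrightarrow> a \<in> J \<Longrightarrow> a \<in> carrier R"
  by (rule ideal.Icarr)

lemma ideal_add: "ideal J R \<Longrightarrow> a \<in> J \<Longrightarrow> b \<in> J \<Longrightarrow> a \<oplus> b \<in> J"
  by (simp add: additive_subgroup.a_closed ideal.axioms(1))

lemma ideal_mult: "ideal J R \<Longrightarrow> r \<in> carrier R \<Longrightarrow> a \<in> J \<Longrightarrow> r \<otimes> a \<in> J"
  by (rule ideal.I_l_closed)

lemma ideal_mult_right: "ideal J R \<Longrightarrow> r \<in> carrier R \<Longrightarrow> a \<in> J \<Longrightarrow> a \<otimes> r \<in> J"
  by (rule ideal.I_r_closed)

lemma ideal_minus: "ideal J R \<Longrightarrow> a \<in> J \<Longrightarrow> b \<in> J \<Longrightarrow> a \<ominus> b \<in> J"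
  by (simp add: a_minus_def additive_subgroup.a_closed additive_subgroup.a_inv_closed ideal.axioms(1))

lemma ideal_zero: "ideal J R \<Longrightarrow> \<zero> \<in> J"
  by (simp add: additive_subgroup.zero_closed ideal.axioms(1))

lemma ideal_comb2:
  "ideal J R \<Longrightarrow> a \<in> J \<Longrightarrow> b \<in> J \<Longrightarrow> r \<in> carrier R \<Longrightarrow> s \<in> carrier R \<Longrightarrow> r \<otimes> a \<oplus> s \<otimes> b \<in> J"
  by (simp add: ideal_add ideal_mult)

lemma ideal_comb2_minus:
  "ideal J R \<Longrightarrow> a \<in> J \<Longrightarrow> b \<in> J \<Longrightarrow> r \<in> carrier R \<Longrightarrow> s \<in> carrier R \<Longrightarrow> r \<otimes> a \<ominus> s \<otimes> b \<in> J"
  by (simp add: ideal_minus ideal_mult)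

lemma ideal_comb3:
  "ideal J R \<Longrightarrow> a \<in> J \<Longrightarrow> b \<in> J \<Longrightarrow> c \<in> J \<Longrightarrow> r \<in> carrier R \<Longrightarrow> s \<in> carrier R \<Longrightarrow> t \<in> carrier R \<Longrightarrow>
    r \<otimes> a \<oplus> s \<otimes> b \<oplus> t \<otimes> c \<in> J"
  by (simp add: ideal_add ideal_mult)

lemma ideal_add_cancel:
  assumes "ideal J R" "a \<oplus> b \<in> J" "a \<in> J" "b \<in> carrier R"
  shows "b \<in> J"
proof -
  have "a \<in> carrier R" using assms ideal_carrier by blast
  then have "b = (a \<oplus> b) \<ominus> a" using assms(4) by algebra
  then show ?thesis using assms ideal_minus by metis
qed

lemma ideal_minus_cancel:
  assumes "ideal J R" "a \<ominus> b \<in> J" "b \<in> J" "a \<in> carrier R"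
  shows "a \<in> J"
proof -
  have "b \<in> carrier R" using assms ideal_carrier by blast
  then have "a = (a \<ominus> b) \<oplus> b" using assms(4) by algebra
  then show ?thesis using assms ideal_add by metis
qed

lemma ideal_minus_cancel_right:
  assumes "ideal J R" "a \<ominus> b \<in> J" "a \<in> J" "b \<in> carrier R"
  shows "b \<in> J"
proof -
  have "a \<in> carrier R" using assms ideal_carrier by blast
  then have "b = a \<ominus> (a \<ominus> b)" using assms(4) by algebra
  then show ?thesis using assms ideal_minus by metis
qed

lemma ideal_eq_carrier: "ideal J R \<Longrightarrow> \<one> \<in> J \<Longrightarrow> J = carrier R"
  by (rule ideal.one_imp_carrier)

lemma ideal_intro:
  assumes "J \<subseteq> carrier R" "\<zero> \<in> J" "\<And>a b. a \<in> J \<Longrightarrow> b \<in> J \<Longrightarrow> a \<oplus> b \<in> J"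
    "\<And>r a. r \<in> carrier R \<Longrightarrow> a \<in> J \<Longrightarrow> r \<otimes> a \<in> J"
  shows "ideal J R"
proof (rule idealI)
  show "ring R" by (rule ring_axioms)
  show "subgroup J (add_monoid R)"
  proof (rule subgroup.intro)
    fix x assume x: "x \<in> J"
    then have xc: "x \<in> carrier R" using assms(1) by blast
    have "\<ominus> x = (\<ominus> \<one>) \<otimes> x" using xc by algebra
    then show "inv\<^bsub>add_monoid R\<^esub> x \<in> J" using assms(4)[of "\<ominus> \<one>" x] x by (simp add: a_inv_def)
  qed (use assms in auto)
  fix a x assume "a \<in> J" "x \<in> carrier R"
  then show "x \<otimes> a \<in> J" "a \<otimes> x \<in> J" using assms(1) assms(4)[of x a] m_comm[of x a] by auto
qed

lemma ideal_colon_ideal: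
  assumes "ideal J R" "K \<subseteq> carrier R"
  shows "ideal (ideal_colon R J K) R"
proof (rule ideal_intro)
  fix a b assume "a \<in> ideal_colon R J K" "b \<in> ideal_colon R J K"
  then show "a \<oplus> b \<in> ideal_colon R J K"
    using assms by (auto simp: ideal_colon_def l_distr subset_iff intro!: ideal_add)
next
  fix r a assume "r \<in> carrier R" "a \<in> ideal_colon R J K"
  then show "r \<otimes> a \<in> ideal_colon R J K"
    using assms ideal_mult[OF assms(1)] by (auto simp: ideal_colon_def m_assoc subset_iff)
qed (use assms ideal_zero in \<open>auto simp: ideal_colon_def\<close>)

lemma ideal_colon_superset: "ideal J R \<Longrightarrow> K \<subseteq> carrier R \<Longrightarrow> J \<subseteq> ideal_colon R J K"
  by (auto simp: ideal_colon_def subset_iff ideal_carrier intro!: ideal_mult_right)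

lemma ideal_colon_singleton:
  "r \<in> ideal_colon R J {z} \<longleftrightarrow> r \<in> carrier R \<and> r \<otimes> z \<in> J"
  by (simp add: ideal_colon_def)

lemma saturated_insertI:
  "c \<in> carrier R \<Longrightarrow> c \<notin> T \<Longrightarrow> d \<in> carrier R \<Longrightarrow> r \<in> carrier R \<Longrightarrow> c \<otimes> r \<ominus> d \<otimes> z \<in> J \<Longrightarrow>
    r \<in> saturated_insert R T J z"
  by (auto simp: saturated_insert_def)

lemma saturated_insert_facts:
  assumes T: "primeideal T R" and J: "ideal J R" and z: "z \<in> carrier R"
  shows "ideal (saturated_insert R T J z) R"
    and "saturated_at R T (saturated_insert R T J z)"
    and "J \<subseteq> saturated_insert R T J z"
    and "z \<in> saturated_insert R T J z"
proof -
  interpret T: primeideal T R by (rule T)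
  have oneT: "\<one> \<notin> T" using T.I_notcarr ideal_eq_carrier[OF T.is_ideal] by blast
  have multT: "c \<otimes> c' \<notin> T" if "c \<in> carrier R" "c' \<in> carrier R" "c \<notin> T" "c' \<notin> T" for c c'
    using that T.I_prime by blast
  show sup: "J \<subseteq> saturated_insert R T J z"
  proof
    fix j assume j: "j \<in> J"
    then have jc: "j \<in> carrier R" using J ideal_carrier by blast
    have "\<one> \<otimes> j \<ominus> \<zero> \<otimes> z = j" using jc z by algebra
    then show "j \<in> saturated_insert R T J z" using j jc oneT
      by (intro saturated_insertI[of \<one> T \<zero>]) auto
  qed
  have zz: "z \<ominus> z = \<zero>" using z by algebra
  then show "z \<in> saturated_insert R T J z"
    using z oneT ideal_zero[OF J] by (intro saturated_insertI[of \<one> T \<one>]) (auto simp: zz)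
  show "ideal (saturated_insert R T J z) R"
  proof (rule ideal_intro)
    show "saturated_insert R T J z \<subseteq> carrier R" by (auto simp: saturated_insert_def)
    show "\<zero> \<in> saturated_insert R T J z" using sup ideal_zero[OF J] by blast
    fix a b assume "a \<in> saturated_insert R T J z" "b \<in> saturated_insert R T J z"
    then obtain c d c' d' where a: "a \<in> carrier R" "b \<in> carrier R" "c \<in> carrier R" "d \<in> carrier R"
       "c' \<in> carrier R" "d' \<in> carrier R" "c \<notin> T" "c' \<notin> T"
       "c \<otimes> a \<ominus> d \<otimes> z \<in> J" "c' \<otimes> b \<ominus> d' \<otimes> z \<in> J"
      by (auto simp: saturated_insert_def)
    have "(c \<otimes> c') \<otimes> (a \<oplus> b) \<ominus> (c' \<otimes> d \<oplus> c \<otimes> d') \<otimes> z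
        = c' \<otimes> (c \<otimes> a \<ominus> d \<otimes> z) \<oplus> c \<otimes> (c' \<otimes> b \<ominus> d' \<otimes> z)"
      using a(1-6) z by algebra
    also have "\<dots> \<in> J" by (rule ideal_comb2[OF J]) (use a in auto)
    finally show "a \<oplus> b \<in> saturated_insert R T J z"
      using a multT[of c c'] by (intro saturated_insertI[of "c \<otimes> c'" T "c' \<otimes> d \<oplus> c \<otimes> d'"]) auto
  next
    fix r a assume "r \<in> carrier R" "a \<in> saturated_insert R T J z"
    then obtain c d where a: "a \<in> carrier R" "r \<in> carrier R" "c \<in> carrier R" "d \<in> carrier R" "c \<notin> T"
       "c \<otimes> a \<ominus> d \<otimes> z \<in> J"
      by (auto simp: saturated_insert_def)
    have "c \<otimes> (r \<otimes> a) \<ominus> (r \<otimes> d) \<otimes> z = r \<otimes> (c \<otimes> a \<ominus> d \<otimes> z)"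
      using a(1-4) z by algebra
    also have "\<dots> \<in> J" by (rule ideal_mult[OF J]) (use a in auto)
    finally show "r \<otimes> a \<in> saturated_insert R T J z"
      using a by (intro saturated_insertI[of c T "r \<otimes> d"]) auto
  qed
  show "saturated_at R T (saturated_insert R T J z)"
    unfolding saturated_at_def nonzerodivisor_mod_def
  proof (intro ballI impI)
    fix c a assume ca: "c \<in> carrier R - T" "a \<in> carrier R" "c \<otimes> a \<in> saturated_insert R T J z"
    then obtain c' d where a: "c' \<in> carrier R" "d \<in> carrier R" "c' \<notin> T"
       "c' \<otimes> (c \<otimes> a) \<ominus> d \<otimes> z \<in> J"
      by (auto simp: saturated_insert_def)
    have "(c' \<otimes> c) \<otimes> a \<ominus> d \<otimes> z \<in> J" using a ca by (simp add: m_assoc)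
    then show "a \<in> saturated_insert R T J z" using a ca multT[of c' c]
      by (intro saturated_insertI[of "c' \<otimes> c" T d]) auto
  qed
qed

lemma saturated_insert_minimal:
  assumes "ideal K R" "saturated_at R T K" "J \<subseteq> K" "z \<in> K"
  shows "saturated_insert R T J z \<subseteq> K"
proof
  fix r assume "r \<in> saturated_insert R T J z"
  then obtain c d where cd: "r \<in> carrier R" "c \<in> carrier R" "d \<in> carrier R" "c \<notin> T" "c \<otimes> r \<ominus> d \<otimes> z \<in> J"
    by (auto simp: saturated_insert_def)
  have "d \<otimes> z \<in> K" using assms cd ideal_mult by blast
  then have "c \<otimes> r \<in> K" using ideal_minus_cancel[OF assms(1), of "c \<otimes> r"] cd assms(3) by auto
  then show "r \<in> K" using saturated_atD[OF assms(2)] cd by blast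
qed

text \<open>If \<open>b \<otimes> z \<notin> J\<close>, the annihilator of
  \<open>b \<otimes> z\<close> modulo \<open>J\<close> contains that of \<open>z\<close> and equals
  it by maximality; so \<open>a \<otimes> b \<otimes> z \<in> J\<close> forces
  \<open>a \<otimes> z \<in> J\<close>. This is the source of associated primes below.\<close>

lemma maximal_colon_prime:
  assumes J: "ideal J R" and z: "z \<in> carrier R - J"
    and max: "\<And>w. w \<in> carrier R - J \<Longrightarrow> ideal_colon R J {z} \<subseteq> ideal_colon R J {w} \<Longrightarrow>
      ideal_colon R J {w} = ideal_colon R J {z}"
  shows "primeideal (ideal_colon R J {z}) R"
proof (rule primeidealI)
  show "ideal (ideal_colon R J {z}) R" using ideal_colon_ideal[OF J] z by auto
  show "cring R" by (rule is_cring)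
  have "\<one> \<notin> ideal_colon R J {z}" using z by (simp add: ideal_colon_singleton)
  then show "carrier R \<noteq> ideal_colon R J {z}" by blast
  fix a b assume ab: "a \<in> carrier R" "b \<in> carrier R" "a \<otimes> b \<in> ideal_colon R J {z}"
  show "a \<in> ideal_colon R J {z} \<or> b \<in> ideal_colon R J {z}"
  proof (rule disjCI)
    assume "b \<notin> ideal_colon R J {z}"
    then have bz: "b \<otimes> z \<in> carrier R - J" using ab z by (auto simp: ideal_colon_singleton)
    have "ideal_colon R J {z} \<subseteq> ideal_colon R J {b \<otimes> z}"
    proof
      fix r assume r: "r \<in> ideal_colon R J {z}"
      then have rr: "r \<in> carrier R" "r \<otimes> z \<in> J" by (auto simp: ideal_colon_singleton)
      have "r \<otimes> (b \<otimes> z) = b \<otimes> (r \<otimes> z)" using rr ab z by (simp add: m_lcomm)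
      then show "r \<in> ideal_colon R J {b \<otimes> z}" using rr ab z ideal_mult[OF J]
        by (auto simp: ideal_colon_singleton)
    qed
    then have "ideal_colon R J {b \<otimes> z} = ideal_colon R J {z}" by (rule max[OF bz])
    moreover have "a \<in> ideal_colon R J {b \<otimes> z}" using ab z by (auto simp: ideal_colon_singleton m_assoc)
    ultimately show "a \<in> ideal_colon R J {z}" by simp
  qed
qed

end

text \<open>Noetherian induction in the form used below, where maximal ideals of suitable families
  take the place of finite generating sets.\<close>

lemma (in noetherian_ring) ex_maximal_ideal_in:
  assumes "\<S> \<noteq> {}" "\<And>J. J \<in> \<S> \<Longrightarrow> ideal J R"
  obtains M where "M \<in> \<S>" "\<And>J. J \<in> \<S> \<Longrightarrow> M \<subseteq> J \<Longrightarrow> J = M"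
proof -
  have "\<exists>M\<in>\<S>. \<forall>J\<in>\<S>. M \<subseteq> J \<longrightarrow> J = M"
  proof (rule subset_Zorn_nonempty[OF assms(1)])
    fix C assume C: "C \<noteq> {}" "subset.chain \<S> C"
    then have "subset.chain {J. ideal J R} C" using assms(2) by (auto simp: subset.chain_def)
    then have "\<Union>C \<in> C" using ideal_chain_is_trivial C by blast
    then show "\<Union>C \<in> \<S>" using C by (auto simp: subset.chain_def)
  qed
  then show ?thesis using that by blast
qed

section \<open>Artinian localizations, Nakayama's lemma and Krull's theorem\<close>

context noetherian_cring
begin

lemma ex_maximal_colon:
  assumes J: "ideal J R" and z: "z \<in> carrier R - J"
  shows "\<exists>w\<in>carrier R - J. ideal_colon R J {z} \<subseteq> ideal_colon R J {w} \<and>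
    (\<forall>v\<in>carrier R - J. ideal_colon R J {w} \<subseteq> ideal_colon R J {v} \<longrightarrow>
      ideal_colon R J {v} = ideal_colon R J {w})"
proof -
  let ?S = "{ideal_colon R J {w} | w. w \<in> carrier R - J \<and> ideal_colon R J {z} \<subseteq> ideal_colon R J {w}}"
  have "?S \<noteq> {}" using z by blast
  moreover have "ideal K R" if "K \<in> ?S" for K using that ideal_colon_ideal[OF J] by auto
  ultimately obtain M where M: "M \<in> ?S" "\<And>K. K \<in> ?S \<Longrightarrow> M \<subseteq> K \<Longrightarrow> K = M"
    by (rule ex_maximal_ideal_in) blast+
  obtain w where w: "M = ideal_colon R J {w}" "w \<in> carrier R - J" "ideal_colon R J {z} \<subseteq> M"
    using M(1) by auto
  have "ideal_colon R J {v} = M" if "v \<in> carrier R - J" "M \<subseteq> ideal_colon R J {v}" for v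
    using that w by (intro M(2)) auto
  then show ?thesis using w by auto
qed

text \<open>If \<open>T\<close> is the only prime between \<open>J\<close> and \<open>T\<close>, the
  localization of \<open>R/J\<close> at \<open>T\<close> is Artinian. Instead of counting lengths, a
  maximal counterexample \<open>M\<close> is enlarged by some \<open>z\<close> with
  \<open>M : z = T\<close>. This adds one simple layer at \<open>T\<close>, and the claim holds
  above it.\<close>

lemma saturated_descending_chain_stabilizes:
  assumes T: "primeideal T R"
    and "ideal J R" "saturated_at R T J"
    and "\<And>Q. primeideal Q R \<Longrightarrow> J \<subseteq> Q \<Longrightarrow> Q \<subseteq> T \<Longrightarrow> Q = T"
    and "\<And>n. ideal (K n) R" "\<And>n. saturated_at R T (K n)" "\<And>n. J \<subseteq> K n" "\<And>n. K (Suc n) \<subseteq> K n"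
  shows "\<exists>n::nat. K (Suc n) = K n"
proof -
  define good where "good J \<longleftrightarrow> (\<forall>K::nat \<Rightarrow> 'a set.
     (\<forall>n. ideal (K n) R \<and> saturated_at R T (K n) \<and> J \<subseteq> K n \<and> K (Suc n) \<subseteq> K n) \<longrightarrow>
     (\<exists>n. K (Suc n) = K n))" for J
  let ?S = "{J. ideal J R \<and> saturated_at R T J \<and>
    (\<forall>Q. primeideal Q R \<longrightarrow> J \<subseteq> Q \<longrightarrow> Q \<subseteq> T \<longrightarrow> Q = T) \<and> \<not> good J}"
  have goodD: "\<exists>n. K (Suc n) = K n" if "good J" "\<And>n. ideal (K n) R" "\<And>n. saturated_at R T (K n)"
    "\<And>n. J \<subseteq> K n" "\<And>n. K (Suc n) \<subseteq> K n" for J and K :: "nat \<Rightarrow> 'a set"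
    using that by (simp add: good_def)
  have "good J"
  proof (rule ccontr)
    assume "\<not> good J"
    then have ne: "?S \<noteq> {}" using assms(2-4) by blast
    obtain M where M: "M \<in> ?S" and max: "\<And>J. J \<in> ?S \<Longrightarrow> M \<subseteq> J \<Longrightarrow> J = M"
      by (rule ex_maximal_ideal_in[OF ne]) auto
    have Mi: "ideal M R" and Ms: "saturated_at R T M"
      and Mp: "\<And>Q. primeideal Q R \<Longrightarrow> M \<subseteq> Q \<Longrightarrow> Q \<subseteq> T \<Longrightarrow> Q = T" using M by auto
    obtain K where Ki: "\<And>n. ideal (K n) R" and Ks: "\<And>n. saturated_at R T (K n)" and MK: "\<And>n. M \<subseteq> K n"
      and Kd: "\<And>n::nat. K (Suc n) \<subseteq> K n" and Kn: "\<And>n. K (Suc n) \<noteq> K n"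
    proof -
      have "\<exists>K. (\<forall>n. ideal (K n) R \<and> saturated_at R T (K n) \<and> M \<subseteq> K n \<and> K (Suc n) \<subseteq> K n) \<and>
        (\<forall>n. K (Suc n) \<noteq> K n)"
        using M by (simp add: good_def)
      then show ?thesis using that by metis
    qed
    have "M \<noteq> carrier R"
    proof
      assume "M = carrier R"
      then have "K n = carrier R" for n using MK[of n] ideal_carrier[OF Ki[of n]] by auto
      then show False using Kn by metis
    qed
    then obtain z0 where "z0 \<in> carrier R - M" using ideal_carrier[OF Mi] by blast
    then obtain z where z: "z \<in> carrier R - M" and
      zmax: "\<And>w. w \<in> carrier R - M \<Longrightarrow> ideal_colon R M {z} \<subseteq> ideal_colon R M {w} \<Longrightarrow>
         ideal_colon R M {w} = ideal_colon R M {z}"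
      using ex_maximal_colon[OF Mi] by meson
    have "primeideal (ideal_colon R M {z}) R" by (rule maximal_colon_prime[OF Mi z zmax])
    moreover have "M \<subseteq> ideal_colon R M {z}" using ideal_colon_superset[OF Mi] z by auto
    moreover have "ideal_colon R M {z} \<subseteq> T"
    proof
      fix x assume "x \<in> ideal_colon R M {z}"
      then show "x \<in> T" using saturated_atD[OF Ms, of x z] z by (auto simp: ideal_colon_singleton)
    qed
    ultimately have colT: "ideal_colon R M {z} = T" by (rule Mp)
    let ?M' = "saturated_insert R T M z"
    have zc: "z \<in> carrier R" using z by simp
    note M' = saturated_insert_facts[OF T Mi zc]
    have gM': "good ?M'"
    proof (rule ccontr)
      assume "\<not> good ?M'"
      then have "?M' \<in> ?S" using M' Mp by blast
      then have "?M' = M" using max M'(3) by blast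
      then show False using M'(4) z by blast
    qed
    show False
    proof (cases "\<forall>n. z \<in> K n")
      case True
      then have "?M' \<subseteq> K n" for n using saturated_insert_minimal[OF Ki Ks MK] by blast
      then have "\<exists>n. K (Suc n) = K n" by (intro goodD[OF gM']) (use Ki Ks Kd in auto)
      then show False using Kn by blast
    next
      case False
      then obtain N where N: "z \<notin> K N" by blast
      have zK: "z \<notin> K (N + n)" for n
        by (induction n) (use N Kd in auto)
      let ?K = "\<lambda>n. saturated_insert R T (K (N + n)) z"
      note K' = saturated_insert_facts[OF T Ki zc]
      have "?M' \<subseteq> ?K n" for n
        by (rule saturated_insert_minimal) (use K'[of "N + n"] MK[of "N + n"] in auto)
      moreover have "?K (Suc n) \<subseteq> ?K n" for n
        by (rule saturated_insert_minimal) (use K'(1,2,4) K'(3)[of "N+n"] Kd[of "N+n"] in auto)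
      ultimately obtain n where n: "?K (Suc n) = ?K n" using goodD[of ?M' ?K] gM' K'(1,2) by metis
      \<comment> \<open>Equality after adjoining \<open>z\<close> descends to the original chain: if
        \<open>d \<otimes> z \<in> K (N + n)\<close>, then \<open>d \<in> T\<close> because
        \<open>K (N + n)\<close> is saturated and omits \<open>z\<close>, so
        \<open>d \<otimes> z\<close> lies in \<open>M\<close> and hence in every member of the
        chain.\<close>
      have "K (N + n) \<subseteq> K (Suc (N + n))"
      proof
        fix r assume r: "r \<in> K (N + n)"
        then have "r \<in> ?K (Suc n)" using K'(3) n by blast
        then obtain c d where cd: "r \<in> carrier R" "c \<in> carrier R" "d \<in> carrier R" "c \<notin> T"
           "c \<otimes> r \<ominus> d \<otimes> z \<in> K (Suc (N + n))"
          by (auto simp: saturated_insert_def)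
        have "c \<otimes> r \<in> K (N + n)" using ideal_mult[OF Ki] cd r by blast
        then have "d \<otimes> z \<in> K (N + n)"
          using ideal_minus_cancel_right[OF Ki, of "c \<otimes> r"] cd zc Kd by blast
        then have "d \<in> T" using saturated_atD[OF Ks] cd zc zK by blast
        then have "d \<otimes> z \<in> M" using colT by (auto simp: ideal_colon_singleton)
        then have "c \<otimes> r \<in> K (Suc (N + n))"
          using ideal_minus_cancel[OF Ki, of "c \<otimes> r"] cd zc MK by blast
        then show "r \<in> K (Suc (N + n))" using saturated_atD[OF Ks] cd by blast
      qed
      then show False using Kd Kn by blast
    qed
  qed
  then show ?thesis using goodD assms(5-8) by metis
qed

text \<open>If \<open>K\<close> is maximal among the saturated ideals with
  \<open>N \<subseteq> K \<subset> M\<close>, then \<open>M/K\<close> becomes simple after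
  localization at \<open>T\<close>; so \<open>T\<close> maps \<open>M\<close> into \<open>K\<close>,
  and \<open>step\<close> gives a contradiction. The premise \<open>step\<close> expresses
  \<open>M = N + TM\<close> in the localization through the saturated ideals containing the
  right-hand side.\<close>

lemma saturated_Nakayama:
  assumes T: "primeideal T R" and M: "ideal M R" "saturated_at R T M" and N: "ideal N R" "saturated_at R T N"
    and step: "\<And>K. ideal K R \<Longrightarrow> saturated_at R T K \<Longrightarrow> N \<subseteq> K \<Longrightarrow> (\<And>a x. a \<in> T \<Longrightarrow> x \<in> M \<Longrightarrow> a \<otimes> x \<in> K)
      \<Longrightarrow> M \<subseteq> K"
    and "N \<subseteq> M"
  shows "M = N"
proof (rule ccontr)
  assume "M \<noteq> N"
  let ?S = "{K. ideal K R \<and> saturated_at R T K \<and> N \<subseteq> K \<and> K \<subset> M}"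
  have ne: "?S \<noteq> {}" using N \<open>N \<subseteq> M\<close> \<open>M \<noteq> N\<close> by blast
  obtain K where K: "K \<in> ?S" and max: "\<And>J. J \<in> ?S \<Longrightarrow> K \<subseteq> J \<Longrightarrow> J = K"
    by (rule ex_maximal_ideal_in[OF ne]) auto
  have Ki: "ideal K R" and Ks: "saturated_at R T K" using K by auto
  have ins: "saturated_insert R T K z = M" if z: "z \<in> M" "z \<notin> K" for z
  proof (rule ccontr)
    have zc: "z \<in> carrier R" using z M ideal_carrier by blast
    note f = saturated_insert_facts[OF T Ki zc]
    assume ne: "saturated_insert R T K z \<noteq> M"
    have "saturated_insert R T K z \<subseteq> M" by (rule saturated_insert_minimal) (use z M K in auto)
    then have "saturated_insert R T K z \<in> ?S" using K f ne by blast
    then have "saturated_insert R T K z = K" using max f(3) by blast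
    then show False using f(4) z by blast
  qed
  obtain w where w: "w \<in> M" "w \<notin> K" using K by blast
  have wc: "w \<in> carrier R" using w M ideal_carrier by blast
  have "a \<otimes> r \<in> K" if a: "a \<in> T" and r: "r \<in> M" for a r
  proof -
    have ac: "a \<in> carrier R" using a T ideal_carrier primeideal.axioms(1) by blast
    have rc: "r \<in> carrier R" using r M ideal_carrier by blast
    have aw: "a \<otimes> w \<in> K"
    proof (rule ccontr)
      assume "a \<otimes> w \<notin> K"
      then have "w \<in> saturated_insert R T K (a \<otimes> w)"
        using ins[of "a \<otimes> w"] ideal_mult[OF M(1) ac] w by blast
      then obtain c d where cd: "c \<in> carrier R" "d \<in> carrier R" "c \<notin> T" "c \<otimes> w \<ominus> d \<otimes> (a \<otimes> w) \<in> K"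
        by (auto simp: saturated_insert_def)
      have "c \<otimes> w \<ominus> d \<otimes> (a \<otimes> w) = (c \<ominus> d \<otimes> a) \<otimes> w" using cd(1,2) ac wc by algebra
      \<comment> \<open>In the localization this element is a unit, being a unit minus an element of
        the maximal ideal; it can therefore be cancelled.\<close>
      moreover have "c \<ominus> d \<otimes> a \<notin> T"
        using cd a ideal_minus_cancel[OF primeideal.axioms(1)[OF T], of c "d \<otimes> a"]
          ideal_mult[OF primeideal.axioms(1)[OF T]] by blast
      ultimately have "w \<in> K" using saturated_atD[OF Ks, of "c \<ominus> d \<otimes> a" w] cd ac wc by auto
      then show False using w by blast
    qed
    have "r \<in> saturated_insert R T K w" using ins w r by blast
    then obtain c d where cd: "c \<in> carrier R" "d \<in> carrier R" "c \<notin> T" "c \<otimes> r \<ominus> d \<otimes> w \<in> K"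
      by (auto simp: saturated_insert_def)
    have "c \<otimes> (a \<otimes> r) = a \<otimes> (c \<otimes> r \<ominus> d \<otimes> w) \<oplus> d \<otimes> (a \<otimes> w)" using cd(1,2) ac wc rc by algebra
    also have "\<dots> \<in> K" by (rule ideal_comb2[OF Ki]) (use cd aw ac in auto)
    finally show "a \<otimes> r \<in> K" using saturated_atD[OF Ks] cd ac rc by blast
  qed
  then have "M \<subseteq> K" using step Ki Ks K by blast
  then show False using K by blast
qed

text \<open>Krull's principal ideal theorem in the form used for exchanging primes in a chain. \<open>S n\<close> is the
  \<open>n\<close>-th symbolic power of \<open>Q\<close> modulo \<open>P\<close>.\<close>

lemma prime_between:
  assumes P: "primeideal P R" and Q: "primeideal Q R" and T: "primeideal T R"
    and PQ: "P \<subset> Q" and QT: "Q \<subset> T" and x: "x \<in> T"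
  shows "\<exists>Q'. primeideal Q' R \<and> P \<subset> Q' \<and> Q' \<subset> T \<and> x \<in> Q'"
proof (rule ccontr)
  assume neg: "\<not> ?thesis"
  interpret P: primeideal P R by (rule P)
  interpret Q: primeideal Q R by (rule Q)
  interpret T: primeideal T R by (rule T)
  note Pi = P.is_ideal and Qi = Q.is_ideal and Ti = T.is_ideal
  have xc: "x \<in> carrier R" using x ideal_carrier[OF Ti] by blast
  have xQ: "x \<notin> Q" using neg Q PQ QT by blast
  have sat_prime: "saturated_at R Q P"
    unfolding saturated_at_def nonzerodivisor_mod_def using P.I_prime PQ by blast
  have sat_mono: "saturated_at R T K" if "saturated_at R Q K" for K
    using that QT by (auto simp: saturated_at_def)
  \<comment> \<open>\<open>F M\<close> is the contraction of \<open>P + QM\<close> from the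
    localization at \<open>Q\<close>. Defining it as an intersection supplies the minimality needed
    for Nakayama's lemma.\<close>
  define F where "F M = \<Inter>{K. ideal K R \<and> saturated_at R Q K \<and> P \<subseteq> K \<and> (\<forall>a\<in>Q. \<forall>r\<in>M. a \<otimes> r \<in> K)}" for M
  define S where "S n = (F ^^ n) (carrier R)" for n
  have satR: "saturated_at R Q (carrier R)" by (simp add: saturated_at_def nonzerodivisor_mod_def)
  have F: "ideal (F M) R" "saturated_at R Q (F M)" "P \<subseteq> F M" "\<And>a r. a \<in> Q \<Longrightarrow> r \<in> M \<Longrightarrow> a \<otimes> r \<in> F M"
    if "M \<subseteq> carrier R" for M
  proof -
    let ?A = "{K. ideal K R \<and> saturated_at R Q K \<and> P \<subseteq> K \<and> (\<forall>a\<in>Q. \<forall>r\<in>M. a \<otimes> r \<in> K)}"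
    have "carrier R \<in> ?A" using that oneideal satR P.a_subset Q.a_subset by auto
    then show "ideal (F M) R" unfolding F_def by (intro i_Intersect) auto
    show "saturated_at R Q (F M)" unfolding F_def saturated_at_def nonzerodivisor_mod_def by blast
  qed (auto simp: F_def)
  have F_min: "F M \<subseteq> K" if "ideal K R" "saturated_at R Q K" "P \<subseteq> K" "\<And>a r. a \<in> Q \<Longrightarrow> r \<in> M \<Longrightarrow> a \<otimes> r \<in> K"
    for M K using that unfolding F_def by blast
  have S: "ideal (S n) R \<and> saturated_at R Q (S n) \<and> P \<subseteq> S n" for n
  proof (induction n)
    case 0
    show ?case using oneideal satR P.a_subset by (simp add: S_def)
  next
    case (Suc n)
    then have "S n \<subseteq> carrier R" using ideal_carrier by blast
    then show ?case using F[of "S n"] by (simp add: S_def)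
  qed
  then have Si: "ideal (S n) R" and Ss: "saturated_at R Q (S n)" and SP: "P \<subseteq> S n" for n by auto
  have Sc: "S n \<subseteq> carrier R" for n using ideal_carrier[OF Si] by blast
  have SSuc: "S (Suc n) = F (S n)" for n by (simp add: S_def)
  have S_dec: "S (Suc n) \<subseteq> S n" for n
    unfolding SSuc
  proof (rule F_min[OF Si Ss SP])
    fix a r assume "a \<in> Q" "r \<in> S n"
    then show "a \<otimes> r \<in> S n" using ideal_mult[OF Si] ideal_carrier[OF Qi] by blast
  qed
  let ?J = "saturated_insert R T P x"
  let ?K = "\<lambda>n. saturated_insert R T (S n) x"
  note J = saturated_insert_facts[OF T Pi xc] and K = saturated_insert_facts[OF T Si xc]
  \<comment> \<open>A prime between \<open>?J\<close> and \<open>T\<close> contains \<open>P\<close>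
    and \<open>x\<close>, and it differs from \<open>P\<close> because \<open>x \<notin> Q\<close>;
    by \<open>neg\<close> only \<open>T\<close> is left.\<close>
  have Jp: "Q' = T" if "primeideal Q' R" "?J \<subseteq> Q'" "Q' \<subseteq> T" for Q'
  proof (rule ccontr)
    assume "Q' \<noteq> T"
    moreover have "P \<subset> Q'" using that J(3,4) xQ PQ by blast
    ultimately show False using that J(4) neg by blast
  qed
  have JK: "?J \<subseteq> ?K n" for n
    by (rule saturated_insert_minimal) (use K[of n] SP[of n] in auto)
  have Kd: "?K (Suc n) \<subseteq> ?K n" for n
    by (rule saturated_insert_minimal) (use K[of n] S_dec[of n] in auto)
  obtain n where n: "?K (Suc n) = ?K n"
  proof -
    have "\<exists>n. ?K (Suc n) = ?K n"
    proof (rule saturated_descending_chain_stabilizes[OF T J(1,2)])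
      show "Q' = T" if "primeideal Q' R" "?J \<subseteq> Q'" "Q' \<subseteq> T" for Q'
        using that by (rule Jp)
      show "ideal (?K n) R" for n by (rule K(1))
      show "saturated_at R T (?K n)" for n by (rule K(2))
      show "?J \<subseteq> ?K n" for n by (rule JK)
      show "?K (Suc n) \<subseteq> ?K n" for n by (rule Kd)
    qed
    then show ?thesis using that by blast
  qed
  \<comment> \<open>Stability after adjoining \<open>x\<close> writes \<open>c \<otimes> r\<close>
    as \<open>d \<otimes> x\<close> modulo \<open>S (Suc n)\<close>. Since \<open>S n\<close> is
    \<open>Q\<close>-saturated and \<open>x \<notin> Q\<close>, also \<open>d \<in> S n\<close>. So
    in the localization at \<open>T\<close> the ideal \<open>S n\<close> is \<open>S (Suc n)\<close>
    plus \<open>x\<close> times itself.\<close>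
  have "S n = S (Suc n)"
  proof (rule saturated_Nakayama[OF T Si sat_mono[OF Ss] Si sat_mono[OF Ss] _ S_dec])
    fix L assume L: "ideal L R" "saturated_at R T L" "S (Suc n) \<subseteq> L" "\<And>a r. a \<in> T \<Longrightarrow> r \<in> S n \<Longrightarrow> a \<otimes> r \<in> L"
    show "S n \<subseteq> L"
    proof
      fix r assume r: "r \<in> S n"
      then have rc: "r \<in> carrier R" using Sc by blast
      have "r \<in> ?K (Suc n)" using r K(3)[of n] unfolding n by blast
      then obtain c d where cd: "c \<in> carrier R" "d \<in> carrier R" "c \<notin> T" "c \<otimes> r \<ominus> d \<otimes> x \<in> S (Suc n)"
        by (auto simp: saturated_insert_def)
      have "c \<otimes> r \<in> S n" by (rule ideal_mult[OF Si cd(1) r])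
      then have "d \<otimes> x \<in> S n"
        using ideal_minus_cancel_right[OF Si[of n], of "c \<otimes> r" "d \<otimes> x"] cd xc S_dec[of n] by auto
      then have "x \<otimes> d \<in> S n" using xc cd m_comm by simp
      then have "d \<in> S n" by (rule saturated_atD[OF Ss xc xQ cd(2)])
      then have "x \<otimes> d \<in> L" using L(4) x by blast
      then have "d \<otimes> x \<in> L" using xc cd m_comm by simp
      then have "c \<otimes> r \<in> L" using ideal_minus_cancel[OF L(1), of "c \<otimes> r" "d \<otimes> x"] cd rc L(3) by auto
      then show "r \<in> L" by (rule saturated_atD[OF L(2) cd(1,3) rc])
    qed
  qed
  \<comment> \<open>Nakayama's lemma a second time, now at \<open>Q\<close>:
    \<open>S n = F (S n)\<close> says that \<open>S n\<close> agrees with \<open>P + Q S n\<close>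
    locally at \<open>Q\<close>.\<close>
  moreover have "S n = P" if "S n = S (Suc n)"
  proof (rule saturated_Nakayama[OF Q Si Ss Pi sat_prime _ SP])
    fix L assume "ideal L R" "saturated_at R Q L" "P \<subseteq> L" "\<And>a r. a \<in> Q \<Longrightarrow> r \<in> S n \<Longrightarrow> a \<otimes> r \<in> L"
    then have "F (S n) \<subseteq> L" by (rule F_min)
    then show "S n \<subseteq> L" by (subst that) (simp only: SSuc)
  qed
  ultimately have SnP: "S n = P" by blast
  have "q \<in> P" if q: "q \<in> Q" for q
  proof -
    have qc: "q \<in> carrier R" using q ideal_carrier[OF Qi] by blast
    have "q [^] k \<in> S k" for k :: nat
    proof (induction k)
      case 0
      show ?case by (simp add: S_def)
    next
      case (Suc k)
      then have "q \<otimes> q [^] k \<in> S (Suc k)" unfolding SSuc using F(4)[OF Sc] q by blast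
      then show ?case using qc m_comm by simp
    qed
    then have "q [^] n \<in> P" using SnP by metis
    moreover have "q [^] k \<in> P \<Longrightarrow> q \<in> P" for k :: nat
    proof (induction k)
      case 0
      then show ?case using P.I_notcarr ideal_eq_carrier[OF Pi] by simp
    next
      case (Suc k)
      then show ?case using P.I_prime[of "q [^] k" q] qc by auto
    qed
    ultimately show ?thesis by blast
  qed
  then show False using PQ by blast
qed

end

section \<open>Local rings with three generators of the maximal ideal\<close>

locale noetherian_local_ring = noetherian_cring R for R (structure) +
  fixes m assumes maximal: "maximalideal m R"
    and maximal_unique: "maximalideal J R \<Longrightarrow> J = m"
begin

lemma m_ideal: "ideal m R"
  using maximal by (rule maximalideal.axioms)

lemma m_carrier: "a \<in> m \<Longrightarrow> a \<in> carrier R"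
  using m_ideal by (rule ideal_carrier)

lemma m_prime: "primeideal m R"
  using maximal by (rule maximalideal_prime)

lemma one_notin_m: "\<one> \<notin> m"
  using maximalideal.I_notcarr[OF maximal] ideal_eq_carrier[OF m_ideal] by blast

lemma proper_ideal_subset:
  assumes J: "ideal J R" "J \<noteq> carrier R"
  shows "J \<subseteq> m"
proof -
  let ?S = "{K. ideal K R \<and> K \<noteq> carrier R \<and> J \<subseteq> K}"
  have ne: "?S \<noteq> {}" using J by blast
  obtain M where M: "M \<in> ?S" and max: "\<And>K. K \<in> ?S \<Longrightarrow> M \<subseteq> K \<Longrightarrow> K = M"
    by (rule ex_maximal_ideal_in[OF ne]) auto
  have "maximalideal M R"
  proof (rule maximalidealI)
    show "ideal M R" "carrier R \<noteq> M" using M by auto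
    fix K assume K: "ideal K R" "M \<subseteq> K" "K \<subseteq> carrier R"
    show "K = M \<or> K = carrier R"
    proof (rule disjCI)
      assume "K \<noteq> carrier R"
      then show "K = M" using K M by (intro max) auto
    qed
  qed
  then show ?thesis using maximal_unique M by blast
qed

lemma unit_outside_m:
  assumes "c \<in> carrier R" "c \<notin> m"
  shows "\<exists>d\<in>carrier R. d \<otimes> c = \<one>"
proof -
  have "PIdl c = carrier R"
    using proper_ideal_subset[OF cgenideal_ideal[OF assms(1)]] cgenideal_self[OF assms(1)] assms(2) by blast
  then have "\<one> \<in> PIdl c" by simp
  then show ?thesis by (auto simp: cgenideal_def)
qed

text \<open>Elements outside \<open>m\<close> are units. Hence the results on saturated ideals apply
  to all ideals when \<open>T\<close> is \<open>m\<close>.\<close>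

lemma ideal_saturated:
  assumes "ideal J R"
  shows "saturated_at R m J"
  unfolding saturated_at_def nonzerodivisor_mod_def
proof (intro ballI impI)
  fix c r assume c: "c \<in> carrier R - m" and r: "r \<in> carrier R" "c \<otimes> r \<in> J"
  obtain d where d: "d \<in> carrier R" "d \<otimes> c = \<one>" using unit_outside_m c by blast
  have "r = d \<otimes> (c \<otimes> r)" using m_assoc[of d c r] d c r by simp
  then show "r \<in> J" using ideal_mult[OF assms d(1) r(2)] by simp
qed

lemma Nakayama:
  assumes M: "ideal M R" and N: "ideal N R" and NM: "N \<subseteq> M"
    and step: "\<And>K x. ideal K R \<Longrightarrow> N \<subseteq> K \<Longrightarrow> (\<And>a y. a \<in> m \<Longrightarrow> y \<in> M \<Longrightarrow> a \<otimes> y \<in> K) \<Longrightarrow> x \<in> M \<Longrightarrow> x \<in> K"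
  shows "M = N"
proof (rule saturated_Nakayama[OF m_prime M ideal_saturated[OF M] N ideal_saturated[OF N] _ NM])
  fix K assume "ideal K R" "N \<subseteq> K" "\<And>a x. a \<in> m \<Longrightarrow> x \<in> M \<Longrightarrow> a \<otimes> x \<in> K"
  then show "M \<subseteq> K" using step by blast
qed

end

section \<open>Sums with principal ideals\<close>

context cring
begin

lemma in_add_PIdl_iff:
  "y \<in> J <+>\<^bsub>R\<^esub> PIdl x \<longleftrightarrow> (\<exists>j\<in>J. \<exists>r\<in>carrier R. y = j \<oplus> r \<otimes> x)"
  by (auto simp: set_add_def' cgenideal_def)

lemma in_two_PIdl_iff:
  "y \<in> PIdl x <+>\<^bsub>R\<^esub> PIdl z \<longleftrightarrow> (\<exists>a\<in>carrier R. \<exists>b\<in>carrier R. y = a \<otimes> x \<oplus> b \<otimes> z)"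
  unfolding in_add_PIdl_iff by (auto simp: cgenideal_def)

lemma add_PIdlI:
  assumes "ideal J R" "x \<in> carrier R" "r \<in> carrier R" "y \<in> carrier R" "y \<ominus> r \<otimes> x \<in> J"
  shows "y \<in> J <+>\<^bsub>R\<^esub> PIdl x"
proof -
  have "y = (y \<ominus> r \<otimes> x) \<oplus> r \<otimes> x" using assms(2-4) by algebra
  then show ?thesis using assms by (auto simp: in_add_PIdl_iff)
qed

lemma add_PIdlE:
  assumes "y \<in> J <+>\<^bsub>R\<^esub> PIdl x" "ideal J R" "x \<in> carrier R"
  obtains r where "r \<in> carrier R" "y \<ominus> r \<otimes> x \<in> J"
proof -
  obtain j r where j: "j \<in> J" "r \<in> carrier R" "y = j \<oplus> r \<otimes> x" using assms by (auto simp: in_add_PIdl_iff)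
  have jc: "j \<in> carrier R" using j assms ideal_carrier by blast
  have "y \<ominus> r \<otimes> x = j" unfolding j(3) using jc j(2) assms(3) by algebra
  then show ?thesis using that j by metis
qed

lemma add_PIdl_ideal:
  "ideal J R \<Longrightarrow> x \<in> carrier R \<Longrightarrow> ideal (J <+>\<^bsub>R\<^esub> PIdl x) R"
  by (simp add: add_ideals cgenideal_ideal)

lemma subset_add_PIdl:
  assumes "ideal J R" "x \<in> carrier R" shows "J \<subseteq> J <+>\<^bsub>R\<^esub> PIdl x"
proof
  fix j assume j: "j \<in> J"
  then have "j \<in> carrier R" using assms ideal_carrier by blast
  then have "j = j \<oplus> \<zero> \<otimes> x" using assms by simp
  then show "j \<in> J <+>\<^bsub>R\<^esub> PIdl x" using j by (auto simp: in_add_PIdl_iff)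
qed

lemma elem_add_PIdl:
  assumes "ideal J R" "x \<in> carrier R" shows "x \<in> J <+>\<^bsub>R\<^esub> PIdl x"
proof -
  have "x = \<zero> \<oplus> \<one> \<otimes> x" using assms by simp
  then show ?thesis using ideal_zero[OF assms(1)] by (auto simp: in_add_PIdl_iff)
qed

end

text \<open>The dimension enters as an explicit chain of four primes ending in \<open>m\<close>, on
  which \<open>prime_between\<close> can act.\<close>

locale local_ring_three_generators = noetherian_local_ring +
  fixes s t u P0 P1 P2
  assumes stu [simp]: "s \<in> carrier R" "t \<in> carrier R" "u \<in> carrier R"
    and m_eq: "m = {s \<otimes> a \<oplus> t \<otimes> b \<oplus> u \<otimes> c | a b c. a \<in> carrier R \<and> b \<in> carrier R \<and> c \<in> carrier R}"
    and primes: "primeideal P0 R" "primeideal P1 R" "primeideal P2 R"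
    and chain: "P0 \<subset> P1" "P1 \<subset> P2" "P2 \<subset> m"
begin

lemma mE:
  assumes "x \<in> m"
  obtains a b c where "a \<in> carrier R" "b \<in> carrier R" "c \<in> carrier R" "x = s \<otimes> a \<oplus> t \<otimes> b \<oplus> u \<otimes> c"
  using assms m_eq by blast

lemma s_in_m: "s \<in> m" and t_in_m: "t \<in> m" and u_in_m: "u \<in> m"
proof -
  have "s = s \<otimes> \<one> \<oplus> t \<otimes> \<zero> \<oplus> u \<otimes> \<zero>" "t = s \<otimes> \<zero> \<oplus> t \<otimes> \<one> \<oplus> u \<otimes> \<zero>" "u = s \<otimes> \<zero> \<oplus> t \<otimes> \<zero> \<oplus> u \<otimes> \<one>"
    by simp_all
  then show "s \<in> m" "t \<in> m" "u \<in> m" unfolding m_eq by blast+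
qed

text \<open>The given chain is exchanged for \<open>P0 \<subset> B \<subset> C \<subset> m\<close>
  with \<open>s \<in> B\<close> and \<open>t \<in> C\<close>. Strictness yields
  \<open>u \<notin> C\<close>, \<open>t \<notin> B\<close> and \<open>s \<notin> P0\<close>, each
  once the prime above has been identified. Primality then gives \<open>C = (s, t) + uC\<close>,
  \<open>B = (s) + tB\<close> and \<open>P0 = sP0\<close>, and Nakayama's lemma removes the last
  summands.\<close>

lemma regular_system:
  shows zero_prime: "primeideal {\<zero>} R"
    and s_prime: "primeideal (PIdl s) R" and t_notin: "t \<notin> PIdl s"
    and st_prime: "primeideal (PIdl s <+>\<^bsub>R\<^esub> PIdl t) R" and u_notin: "u \<notin> PIdl s <+>\<^bsub>R\<^esub> PIdl t"
    and s_nonzero: "s \<noteq> \<zero>"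
proof -
  \<comment> \<open>\<open>Q\<close> is auxiliary: \<open>s\<close> must first lie in a prime of the
    upper level, so that an exchange below that prime can put it into \<open>B\<close>. Afterwards
    \<open>Q\<close> is the prime between \<open>B\<close> and \<open>m\<close> that is exchanged
    for \<open>C\<close>.\<close>
  obtain Q where Q: "primeideal Q R" "P1 \<subset> Q" "Q \<subset> m" "s \<in> Q"
    using prime_between[OF primes(2,3) m_prime chain(2,3) s_in_m] by blast
  obtain B where B: "primeideal B R" "P0 \<subset> B" "B \<subset> Q" "s \<in> B"
    using prime_between[OF primes(1,2) Q(1) chain(1) Q(2) Q(4)] by blast
  obtain C where C: "primeideal C R" "B \<subset> C" "C \<subset> m" "t \<in> C"
    using prime_between[OF B(1) Q(1) m_prime B(3) Q(3) t_in_m] by blast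
  note Ai = primeideal.axioms(1)[OF primes(1)] and Bi = primeideal.axioms(1)[OF B(1)]
    and Ci = primeideal.axioms(1)[OF C(1)]
  have si: "ideal (PIdl s) R" by (simp add: cgenideal_ideal)
  have sti: "ideal (PIdl s <+>\<^bsub>R\<^esub> PIdl t) R" by (simp add: add_PIdl_ideal si)
  have st_in: "s \<otimes> a \<oplus> t \<otimes> b \<in> PIdl s <+>\<^bsub>R\<^esub> PIdl t" if "a \<in> carrier R" "b \<in> carrier R" for a b
    using that by (auto simp: in_two_PIdl_iff m_comm)
  have uC: "u \<notin> C"
  proof
    assume u: "u \<in> C"
    have "m \<subseteq> C"
    proof
      fix x assume "x \<in> m"
      then obtain a b c where "a \<in> carrier R" "b \<in> carrier R" "c \<in> carrier R" "x = s \<otimes> a \<oplus> t \<otimes> b \<oplus> u \<otimes> c"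
        by (rule mE)
      then show "x \<in> C" using B(4) C(2,4) u by (auto intro!: ideal_add[OF Ci] ideal_mult_right[OF Ci])
    qed
    then show False using C(3) by blast
  qed
  have C_dec: "\<exists>a\<in>carrier R. \<exists>b\<in>carrier R. \<exists>c\<in>C. x = s \<otimes> a \<oplus> t \<otimes> b \<oplus> u \<otimes> c" if x: "x \<in> C" for x
  proof -
    have "x \<in> m" using x C(3) by blast
    then obtain a b c where abc: "a \<in> carrier R" "b \<in> carrier R" "c \<in> carrier R" "x = s \<otimes> a \<oplus> t \<otimes> b \<oplus> u \<otimes> c"
      by (rule mE)
    have "s \<otimes> a \<oplus> t \<otimes> b \<in> C"
      using B(4) C(2,4) abc by (auto intro!: ideal_add[OF Ci] ideal_mult_right[OF Ci])
    then have "u \<otimes> c \<in> C" using ideal_add_cancel[OF Ci, of "s \<otimes> a \<oplus> t \<otimes> b" "u \<otimes> c"] x abc by auto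
    then have "c \<in> C" using primeideal.I_prime[OF C(1), of u c] uC abc by auto
    then show ?thesis using abc by blast
  qed
  have C_eq: "C = PIdl s <+>\<^bsub>R\<^esub> PIdl t"
  proof (rule Nakayama[OF Ci sti])
    show "PIdl s <+>\<^bsub>R\<^esub> PIdl t \<subseteq> C"
      using B(4) C(2,4) by (auto simp: in_two_PIdl_iff intro!: ideal_add[OF Ci] ideal_mult[OF Ci])
    fix K x assume K: "ideal K R" "PIdl s <+>\<^bsub>R\<^esub> PIdl t \<subseteq> K" "\<And>a y. a \<in> m \<Longrightarrow> y \<in> C \<Longrightarrow> a \<otimes> y \<in> K" and x: "x \<in> C"
    obtain a b c where abc: "a \<in> carrier R" "b \<in> carrier R" "c \<in> C" "x = s \<otimes> a \<oplus> t \<otimes> b \<oplus> u \<otimes> c"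
      using C_dec[OF x] by blast
    have "s \<otimes> a \<oplus> t \<otimes> b \<in> K" using st_in[OF abc(1,2)] K(2) by blast
    then show "x \<in> K" unfolding abc(4) using K(3)[OF u_in_m abc(3)] by (rule ideal_add[OF K(1)])
  qed
  have tB: "t \<notin> B"
  proof
    assume t: "t \<in> B"
    have "C \<subseteq> B" unfolding C_eq
      using B(4) t by (auto simp: in_two_PIdl_iff intro!: ideal_add[OF Bi] ideal_mult[OF Bi])
    then show False using C(2) by blast
  qed
  have B_eq: "B = PIdl s"
  proof (rule Nakayama[OF Bi si])
    show "PIdl s \<subseteq> B" using B(4) by (auto simp: cgenideal_def intro!: ideal_mult[OF Bi])
    fix K x assume K: "ideal K R" "PIdl s \<subseteq> K" "\<And>a y. a \<in> m \<Longrightarrow> y \<in> B \<Longrightarrow> a \<otimes> y \<in> K" and x: "x \<in> B"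
    have "x \<in> PIdl s <+>\<^bsub>R\<^esub> PIdl t" using x C(2) C_eq by blast
    then obtain r where r: "r \<in> carrier R" "x \<ominus> r \<otimes> t \<in> PIdl s" by (rule add_PIdlE[OF _ si]) auto
    have xc: "x \<in> carrier R" using ideal_carrier[OF Bi x] .
    have "x \<ominus> r \<otimes> t \<in> B" using r(2) B(4) by (auto simp: cgenideal_def intro!: ideal_mult[OF Bi])
    then have "r \<otimes> t \<in> B" using ideal_minus_cancel_right[OF Bi, of x "r \<otimes> t"] x r by auto
    then have "r \<in> B" using primeideal.I_prime[OF B(1), of r t] tB r by auto
    then have "t \<otimes> r \<in> K" using K(3) t_in_m by blast
    then have "r \<otimes> t \<in> K" using r m_comm by simp
    then show "x \<in> K" using ideal_minus_cancel[OF K(1), of x "r \<otimes> t"] r K(2) xc by auto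
  qed
  have sA: "s \<notin> P0"
  proof
    assume s: "s \<in> P0"
    have "B \<subseteq> P0" unfolding B_eq using s by (auto simp: cgenideal_def intro!: ideal_mult[OF Ai])
    then show False using B(2) by blast
  qed
  have A_eq: "P0 = {\<zero>}"
  proof (rule Nakayama[OF Ai zeroideal])
    show "{\<zero>} \<subseteq> P0" using ideal_zero[OF Ai] by simp
    fix K x assume K: "ideal K R" "\<And>a y. a \<in> m \<Longrightarrow> y \<in> P0 \<Longrightarrow> a \<otimes> y \<in> K" and x: "x \<in> P0"
    have "x \<in> PIdl s" using x B(2) B_eq by blast
    then obtain r where r: "r \<in> carrier R" "x = r \<otimes> s" by (auto simp: cgenideal_def)
    then have "r \<in> P0" using primeideal.I_prime[OF primes(1), of r s] sA x by auto
    then have "s \<otimes> r \<in> K" using K(2) s_in_m by blast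
    then show "x \<in> K" using r m_comm by simp
  qed
  show "primeideal {\<zero>} R" using primes(1) A_eq by simp
  show "primeideal (PIdl s) R" "t \<notin> PIdl s" using B(1) tB B_eq by auto
  show "primeideal (PIdl s <+>\<^bsub>R\<^esub> PIdl t) R" "u \<notin> PIdl s <+>\<^bsub>R\<^esub> PIdl t" using C(1) uC C_eq by auto
  show "s \<noteq> \<zero>" using sA ideal_zero[OF Ai] by blast
qed

end

sublocale local_ring_three_generators \<subseteq> "domain" R
  by (rule zeroprimeideal_domainI[OF zero_prime])

section \<open>Koszul homology and regular sequences\<close>

context local_ring_three_generators
begin

text \<open>Vanishing of the second Koszul homology of \<open>R\<close>: primality of
  \<open>(s)\<close> makes \<open>a\<close> a multiple of \<open>s\<close>, and cancelling
  \<open>s\<close> shows that the same factor \<open>z\<close> serves the other two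
  coordinates.\<close>

lemma koszul2:
  assumes "a \<in> carrier R" "b \<in> carrier R" "c \<in> carrier R"
    and "s \<otimes> b = t \<otimes> a" "s \<otimes> c = u \<otimes> a" "t \<otimes> c = u \<otimes> b"
  obtains z where "z \<in> carrier R" "a = s \<otimes> z" "b = t \<otimes> z" "c = u \<otimes> z"
proof -
  have "t \<otimes> a \<in> PIdl s" using assms(1,2) assms(4)[symmetric] by (auto simp: cgenideal_def m_comm)
  then have "a \<in> PIdl s" using primeideal.I_prime[OF s_prime, of t a] t_notin assms by auto
  then obtain z where z: "z \<in> carrier R" "a = s \<otimes> z" by (auto simp: cgenideal_def m_comm)
  have "s \<otimes> b = s \<otimes> (t \<otimes> z)" using assms(4) z by (simp add: m_lcomm)
  then have "b = t \<otimes> z" using m_lcancel[OF s_nonzero, of b "t \<otimes> z"] z assms by auto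
  moreover have "s \<otimes> c = s \<otimes> (u \<otimes> z)" using assms(5) z by (simp add: m_lcomm)
  then have "c = u \<otimes> z" using m_lcancel[OF s_nonzero, of c "u \<otimes> z"] z assms by auto
  ultimately show ?thesis using that z by blast
qed

text \<open>Vanishing of the first Koszul homology of \<open>R\<close>: a vector orthogonal to
  \<open>(s, t, u)\<close> is a cross product \<open>(s, t, u) \<times> (a, b, c)\<close>.
  Regularity of \<open>u\<close> modulo \<open>(s, t)\<close>, of \<open>t\<close> modulo
  \<open>(s)\<close> and of \<open>s\<close> determines \<open>r\<close>, \<open>q\<close> and
  \<open>p\<close> in turn.\<close>

lemma koszul1:
  assumes pqr: "p \<in> carrier R" "q \<in> carrier R" "r \<in> carrier R"
    and eq: "s \<otimes> p \<oplus> t \<otimes> q \<oplus> u \<otimes> r = \<zero>"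
  obtains a b c where "a \<in> carrier R" "b \<in> carrier R" "c \<in> carrier R"
    "p = t \<otimes> c \<ominus> u \<otimes> b" "q = u \<otimes> a \<ominus> s \<otimes> c" "r = s \<otimes> b \<ominus> t \<otimes> a"
proof -
  have "u \<otimes> r = (s \<otimes> p \<oplus> t \<otimes> q \<oplus> u \<otimes> r) \<ominus> (s \<otimes> p \<oplus> t \<otimes> q)" using pqr stu by algebra
  also have "\<dots> = (\<ominus> p) \<otimes> s \<oplus> (\<ominus> q) \<otimes> t" unfolding eq using pqr stu by algebra
  also have "\<dots> \<in> PIdl s <+>\<^bsub>R\<^esub> PIdl t" unfolding in_two_PIdl_iff
    by (rule bexI[of _ "\<ominus> p"], rule bexI[of _ "\<ominus> q"]) (use pqr in auto)
  finally have "r \<in> PIdl s <+>\<^bsub>R\<^esub> PIdl t" using primeideal.I_prime[OF st_prime, of u r] u_notin pqr by auto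
  then obtain x y where xy: "x \<in> carrier R" "y \<in> carrier R" "r = x \<otimes> s \<oplus> y \<otimes> t"
    by (auto simp: in_two_PIdl_iff)
  define a where "a = \<ominus> y"
  have a: "a \<in> carrier R" "r = s \<otimes> x \<ominus> t \<otimes> a" unfolding xy(3) a_def using xy(1,2) stu by (simp, algebra)
  have "t \<otimes> (q \<ominus> u \<otimes> a) = (s \<otimes> p \<oplus> t \<otimes> q \<oplus> u \<otimes> r) \<ominus> s \<otimes> (p \<oplus> u \<otimes> x)"
    unfolding a(2) using pqr(1,2) stu xy(1) a(1) by algebra
  also have "\<dots> = s \<otimes> (\<ominus> (p \<oplus> u \<otimes> x))" unfolding eq using pqr(1,2) stu xy(1) by algebra
  finally have e: "t \<otimes> (q \<ominus> u \<otimes> a) = s \<otimes> (\<ominus> (p \<oplus> u \<otimes> x))" .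
  also have "\<dots> \<in> PIdl s" using pqr xy by (auto simp: cgenideal_def m_comm[of s])
  finally have "q \<ominus> u \<otimes> a \<in> PIdl s"
    using primeideal.I_prime[OF s_prime, of t "q \<ominus> u \<otimes> a"] t_notin pqr a by auto
  then obtain w where w: "w \<in> carrier R" "q \<ominus> u \<otimes> a = s \<otimes> w" by (auto simp: cgenideal_def m_comm)
  have "s \<otimes> (\<ominus> (p \<oplus> u \<otimes> x)) = s \<otimes> (t \<otimes> w)" unfolding e[symmetric] w(2) using w(1) by (simp add: m_lcomm)
  then have e2: "\<ominus> (p \<oplus> u \<otimes> x) = t \<otimes> w"
    using m_lcancel[OF s_nonzero, of "\<ominus> (p \<oplus> u \<otimes> x)" "t \<otimes> w"] w pqr xy by auto
  have "p = \<ominus> (\<ominus> (p \<oplus> u \<otimes> x)) \<ominus> u \<otimes> x" using pqr(1) xy(1) stu by algebra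
  also have "\<dots> = t \<otimes> (\<ominus> w) \<ominus> u \<otimes> x" unfolding e2 using w(1) xy(1) stu by algebra
  finally have p: "p = t \<otimes> (\<ominus> w) \<ominus> u \<otimes> x" .
  have "q = (q \<ominus> u \<otimes> a) \<oplus> u \<otimes> a" using pqr a(1) stu by algebra
  also have "\<dots> = u \<otimes> a \<ominus> s \<otimes> (\<ominus> w)" unfolding w(2) using w(1) a(1) stu by algebra
  finally have q: "q = u \<otimes> a \<ominus> s \<otimes> (\<ominus> w)" .
  show ?thesis using that[of a x "\<ominus> w"] a p q xy w by auto
qed

lemma in_ideal_if_s_t_u:
  assumes J: "ideal J R" and z: "z \<in> carrier R" "s \<otimes> z \<in> J" "t \<otimes> z \<in> J" "u \<otimes> z \<in> J" and x: "x \<in> m"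
  shows "x \<otimes> z \<in> J"
proof -
  obtain a b c where abc: "a \<in> carrier R" "b \<in> carrier R" "c \<in> carrier R" "x = s \<otimes> a \<oplus> t \<otimes> b \<oplus> u \<otimes> c"
    using mE[OF x] .
  have "x \<otimes> z = a \<otimes> (s \<otimes> z) \<oplus> b \<otimes> (t \<otimes> z) \<oplus> c \<otimes> (u \<otimes> z)"
    unfolding abc(4) using abc(1-3) z(1) stu by algebra
  also have "\<dots> \<in> J" by (rule ideal_comb3[OF J]) (use z abc in auto)
  finally show ?thesis .
qed

text \<open>Every \<open>x \<in> m\<close> annihilates the second Koszul homology of
  \<open>R/J\<close>. If \<open>x\<close> is the inner product of \<open>(s, t, u)\<close> with
  \<open>(k, l, n)\<close>, the inner product of \<open>(a, b, c)\<close> with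
  \<open>(k, l, n)\<close> serves as \<open>w\<close>.\<close>

lemma minors_multiple:
  assumes J: "ideal J R" and x: "x \<in> m"
    and abc: "a \<in> carrier R" "b \<in> carrier R" "c \<in> carrier R"
    and rel: "s \<otimes> b \<ominus> t \<otimes> a \<in> J" "s \<otimes> c \<ominus> u \<otimes> a \<in> J" "t \<otimes> c \<ominus> u \<otimes> b \<in> J"
  obtains w where "w \<in> carrier R" "w \<otimes> s \<ominus> x \<otimes> a \<in> J" "w \<otimes> t \<ominus> x \<otimes> b \<in> J" "w \<otimes> u \<ominus> x \<otimes> c \<in> J"
proof -
  obtain k l n where kln: "k \<in> carrier R" "l \<in> carrier R" "n \<in> carrier R" "x = s \<otimes> k \<oplus> t \<otimes> l \<oplus> u \<otimes> n"
    using mE[OF x] .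
  let ?w = "k \<otimes> a \<oplus> l \<otimes> b \<oplus> n \<otimes> c"
  have "?w \<otimes> s \<ominus> x \<otimes> a = l \<otimes> (s \<otimes> b \<ominus> t \<otimes> a) \<oplus> n \<otimes> (s \<otimes> c \<ominus> u \<otimes> a)"
    unfolding kln(4) using kln(1-3) abc stu by algebra
  also have "\<dots> \<in> J" by (rule ideal_comb2[OF J]) (use rel kln in auto)
  finally have 1: "?w \<otimes> s \<ominus> x \<otimes> a \<in> J" .
  have "?w \<otimes> t \<ominus> x \<otimes> b = n \<otimes> (t \<otimes> c \<ominus> u \<otimes> b) \<ominus> k \<otimes> (s \<otimes> b \<ominus> t \<otimes> a)"
    unfolding kln(4) using kln(1-3) abc stu by algebra
  also have "\<dots> \<in> J" by (rule ideal_comb2_minus[OF J]) (use rel kln in auto)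
  finally have 2: "?w \<otimes> t \<ominus> x \<otimes> b \<in> J" .
  have "?w \<otimes> u \<ominus> x \<otimes> c = (\<ominus> k) \<otimes> (s \<otimes> c \<ominus> u \<otimes> a) \<ominus> l \<otimes> (t \<otimes> c \<ominus> u \<otimes> b)"
    unfolding kln(4) using kln(1-3) abc stu by algebra
  also have "\<dots> \<in> J" by (rule ideal_comb2_minus[OF J]) (use rel kln in auto)
  finally have 3: "?w \<otimes> u \<ominus> x \<otimes> c \<in> J" .
  show ?thesis using that[OF _ 1 2 3] kln abc by auto
qed

text \<open>With \<open>w\<close> and \<open>v\<close> obtained from \<open>x\<close> and
  \<open>y\<close> by \<open>minors_multiple\<close>, the element
  \<open>y \<otimes> w \<ominus> x \<otimes> v\<close> is annihilated by \<open>m\<close> modulo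
  \<open>J\<close>, hence lies in \<open>J\<close>. Regularity of \<open>y\<close> then makes
  \<open>w\<close> a multiple \<open>z \<otimes> x\<close> modulo \<open>J\<close>, and cancelling
  \<open>x\<close> shows that \<open>z\<close> is the required factor.\<close>

lemma koszul2_mod:
  assumes J: "ideal J R" and x: "x \<in> m" "nonzerodivisor_mod R J x"
    and y: "y \<in> m" "nonzerodivisor_mod R (J <+>\<^bsub>R\<^esub> PIdl x) y"
    and abc: "a \<in> carrier R" "b \<in> carrier R" "c \<in> carrier R"
    and rel: "s \<otimes> b \<ominus> t \<otimes> a \<in> J" "s \<otimes> c \<ominus> u \<otimes> a \<in> J" "t \<otimes> c \<ominus> u \<otimes> b \<in> J"
  obtains z where "z \<in> carrier R" "a \<ominus> s \<otimes> z \<in> J" "b \<ominus> t \<otimes> z \<in> J" "c \<ominus> u \<otimes> z \<in> J"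
proof -
  have xc: "x \<in> carrier R" and yc: "y \<in> carrier R" using x y m_carrier by auto
  obtain w where w: "w \<in> carrier R"
    and ws: "w \<otimes> s \<ominus> x \<otimes> a \<in> J" "w \<otimes> t \<ominus> x \<otimes> b \<in> J" "w \<otimes> u \<ominus> x \<otimes> c \<in> J"
    by (rule minors_multiple[OF J x(1) abc rel])
  obtain v where v: "v \<in> carrier R"
    and vs: "v \<otimes> s \<ominus> y \<otimes> a \<in> J" "v \<otimes> t \<ominus> y \<otimes> b \<in> J" "v \<otimes> u \<ominus> y \<otimes> c \<in> J"
    by (rule minors_multiple[OF J y(1) abc rel])
  let ?d = "y \<otimes> w \<ominus> x \<otimes> v"
  have kill: "e \<otimes> ?d \<in> J" if "e \<in> carrier R" "f \<in> carrier R" "w \<otimes> e \<ominus> x \<otimes> f \<in> J" "v \<otimes> e \<ominus> y \<otimes> f \<in> J" for e f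
  proof -
    have "e \<otimes> ?d = y \<otimes> (w \<otimes> e \<ominus> x \<otimes> f) \<ominus> x \<otimes> (v \<otimes> e \<ominus> y \<otimes> f)"
      using that(1,2) w v xc yc by algebra
    also have "\<dots> \<in> J" by (rule ideal_comb2_minus[OF J]) (use that xc yc in auto)
    finally show ?thesis .
  qed
  have dc: "?d \<in> carrier R" using w v xc yc by auto
  have "x \<otimes> ?d \<in> J"
    by (rule in_ideal_if_s_t_u[OF J dc _ _ _ x(1)]) (use kill ws vs abc stu in blast)+
  then have d: "?d \<in> J" using nonzerodivisor_modD[OF x(2) dc] by blast
  have "y \<otimes> w \<in> J <+>\<^bsub>R\<^esub> PIdl x"
    by (rule add_PIdlI[OF J xc v]) (use d w v xc yc in \<open>auto simp: m_comm\<close>)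
  then have "w \<in> J <+>\<^bsub>R\<^esub> PIdl x" using nonzerodivisor_modD[OF y(2) w] by blast
  then obtain z where z: "z \<in> carrier R" "w \<ominus> z \<otimes> x \<in> J" by (rule add_PIdlE[OF _ J xc])
  have "f \<ominus> e \<otimes> z \<in> J" if "e \<in> carrier R" "f \<in> carrier R" "w \<otimes> e \<ominus> x \<otimes> f \<in> J" for e f
  proof -
    have "x \<otimes> (f \<ominus> e \<otimes> z) = e \<otimes> (w \<ominus> z \<otimes> x) \<ominus> \<one> \<otimes> (w \<otimes> e \<ominus> x \<otimes> f)"
      using that(1,2) w z(1) xc by algebra
    also have "\<dots> \<in> J" by (rule ideal_comb2_minus[OF J]) (use that z in auto)
    finally show ?thesis using nonzerodivisor_modD[OF x(2)] that z by auto
  qed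
  then show ?thesis using that[OF z(1)] ws abc stu by blast
qed

text \<open>The homotopy attached to \<open>x\<close> turns \<open>(p, q, r)\<close> into a
  second-degree cycle modulo \<open>J\<close> and \<open>x\<close>. By \<open>koszul2_mod\<close>
  for \<open>y, v\<close> it is a boundary there. The error is a multiple of \<open>x\<close>, and
  cancelling \<open>x\<close> leaves the desired \<open>(a', b', c')\<close>.\<close>

lemma koszul1_mod:
  assumes J: "ideal J R" and x: "x \<in> m" "nonzerodivisor_mod R J x"
    and y: "y \<in> m" "nonzerodivisor_mod R (J <+>\<^bsub>R\<^esub> PIdl x) y"
    and v: "v \<in> m" "nonzerodivisor_mod R ((J <+>\<^bsub>R\<^esub> PIdl x) <+>\<^bsub>R\<^esub> PIdl y) v"
    and pqr: "p \<in> carrier R" "q \<in> carrier R" "r \<in> carrier R"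
    and rel: "s \<otimes> p \<oplus> t \<otimes> q \<oplus> u \<otimes> r \<in> J"
  obtains a b c where "a \<in> carrier R" "b \<in> carrier R" "c \<in> carrier R"
    "p \<ominus> (t \<otimes> c \<ominus> u \<otimes> b) \<in> J" "q \<ominus> (u \<otimes> a \<ominus> s \<otimes> c) \<in> J" "r \<ominus> (s \<otimes> b \<ominus> t \<otimes> a) \<in> J"
proof -
  have xc: "x \<in> carrier R" using x m_carrier by auto
  let ?Jx = "J <+>\<^bsub>R\<^esub> PIdl x"
  let ?h = "s \<otimes> p \<oplus> t \<otimes> q \<oplus> u \<otimes> r"
  have Jx: "ideal ?Jx R" by (rule add_PIdl_ideal[OF J xc])
  obtain k l n where kln: "k \<in> carrier R" "l \<in> carrier R" "n \<in> carrier R" "x = s \<otimes> k \<oplus> t \<otimes> l \<oplus> u \<otimes> n"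
    using mE[OF x(1)] .
  \<comment> \<open>This is \<open>(p, q, r) \<times> (k, l, n)\<close>. The expansion of the triple
    product \<open>(s, t, u) \<times> ((p, q, r) \<times> (k, l, n))\<close> gives the identities
    \<open>ba\<close>, \<open>ca\<close> and \<open>cb\<close>.\<close>
  define a b c where "a = n \<otimes> q \<ominus> l \<otimes> r" and "b = k \<otimes> r \<ominus> n \<otimes> p" and "c = l \<otimes> p \<ominus> k \<otimes> q"
  have abc: "a \<in> carrier R" "b \<in> carrier R" "c \<in> carrier R" using kln pqr by (auto simp: a_def b_def c_def)
  have hJx: "g \<otimes> ?h \<in> J" if "g \<in> carrier R" for g using ideal_mult[OF J that rel] .
  have ba: "s \<otimes> b \<ominus> t \<otimes> a = x \<otimes> r \<ominus> n \<otimes> ?h"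
    unfolding a_def b_def kln(4) using kln(1-3) pqr stu by algebra
  have ca: "u \<otimes> a \<ominus> s \<otimes> c = x \<otimes> q \<ominus> l \<otimes> ?h"
    unfolding a_def c_def kln(4) using kln(1-3) pqr stu by algebra
  have cb: "t \<otimes> c \<ominus> u \<otimes> b = x \<otimes> p \<ominus> k \<otimes> ?h"
    unfolding c_def b_def kln(4) using kln(1-3) pqr stu by algebra
  have in_Jx: "x \<otimes> f \<ominus> g \<otimes> ?h \<in> ?Jx" if "f \<in> carrier R" "g \<in> carrier R" for f g
    by (rule ideal_minus[OF Jx])
      (use hJx[OF that(2)] subset_add_PIdl[OF J xc] elem_add_PIdl[OF J xc] that ideal_mult_right[OF Jx] in blast)+
  have relx: "s \<otimes> b \<ominus> t \<otimes> a \<in> ?Jx" "t \<otimes> c \<ominus> u \<otimes> b \<in> ?Jx"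
    unfolding ba cb using in_Jx kln pqr by auto
  have "s \<otimes> c \<ominus> u \<otimes> a = (\<ominus> \<one>) \<otimes> (u \<otimes> a \<ominus> s \<otimes> c)" using abc stu by algebra
  also have "\<dots> \<in> ?Jx" unfolding ca by (rule ideal_mult[OF Jx _ in_Jx]) (use kln pqr in auto)
  finally have relx2: "s \<otimes> c \<ominus> u \<otimes> a \<in> ?Jx" .
  obtain z where z: "z \<in> carrier R" "a \<ominus> s \<otimes> z \<in> ?Jx" "b \<ominus> t \<otimes> z \<in> ?Jx" "c \<ominus> u \<otimes> z \<in> ?Jx"
    by (rule koszul2_mod[OF Jx y v abc relx(1) relx2 relx(2)])
  obtain a' where a': "a' \<in> carrier R" "(a \<ominus> s \<otimes> z) \<ominus> a' \<otimes> x \<in> J" by (rule add_PIdlE[OF z(2) J xc])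
  obtain b' where b': "b' \<in> carrier R" "(b \<ominus> t \<otimes> z) \<ominus> b' \<otimes> x \<in> J" by (rule add_PIdlE[OF z(3) J xc])
  obtain c' where c': "c' \<in> carrier R" "(c \<ominus> u \<otimes> z) \<ominus> c' \<otimes> x \<in> J" by (rule add_PIdlE[OF z(4) J xc])
  \<comment> \<open>One computation for all three coordinates. The terms with \<open>z\<close>
    cancel because \<open>(s, t, u) \<times> (s, t, u) = 0\<close>.\<close>
  have final: "f \<ominus> (d1 \<otimes> g' \<ominus> d2 \<otimes> h') \<in> J"
    if "d1 \<in> carrier R" "d2 \<in> carrier R" "g \<in> carrier R" "h \<in> carrier R" "g' \<in> carrier R" "h' \<in> carrier R"
      "f \<in> carrier R" "e \<in> carrier R" "d1 \<otimes> g \<ominus> d2 \<otimes> h = x \<otimes> f \<ominus> e \<otimes> ?h"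
      and gh: "(g \<ominus> d2 \<otimes> z) \<ominus> g' \<otimes> x \<in> J" "(h \<ominus> d1 \<otimes> z) \<ominus> h' \<otimes> x \<in> J" for d1 d2 f g h g' h' e
  proof -
    have hc: "?h \<in> carrier R" using pqr by simp
    have "x \<otimes> (f \<ominus> (d1 \<otimes> g' \<ominus> d2 \<otimes> h')) = (x \<otimes> f \<ominus> e \<otimes> ?h) \<oplus> e \<otimes> ?h \<ominus> d1 \<otimes> g' \<otimes> x \<oplus> d2 \<otimes> h' \<otimes> x"
      using that(1-8) xc hc by algebra
    also have "\<dots> = d1 \<otimes> ((g \<ominus> d2 \<otimes> z) \<ominus> g' \<otimes> x) \<oplus> (\<ominus> d2) \<otimes> ((h \<ominus> d1 \<otimes> z) \<ominus> h' \<otimes> x) \<oplus> e \<otimes> ?h"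
      unfolding that(9)[symmetric] using that(1-8) xc hc z(1) by algebra
    also have "\<dots> \<in> J" by (rule ideal_comb3[OF J]) (use that rel in auto)
    finally show ?thesis using nonzerodivisor_modD[OF x(2)] that by auto
  qed
  have "p \<ominus> (t \<otimes> c' \<ominus> u \<otimes> b') \<in> J"
    by (rule final[OF _ _ _ _ _ _ _ _ cb]) (use abc a' b' c' kln pqr in auto)
  moreover have "q \<ominus> (u \<otimes> a' \<ominus> s \<otimes> c') \<in> J"
    by (rule final[OF _ _ _ _ _ _ _ _ ca]) (use abc a' b' c' kln pqr in auto)
  moreover have "r \<ominus> (s \<otimes> b' \<ominus> t \<otimes> a') \<in> J"
    by (rule final[OF _ _ _ _ _ _ _ _ ba]) (use abc a' b' c' kln pqr in auto)
  ultimately show ?thesis using that[OF a'(1) b'(1) c'(1)] by blast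
qed

end

section \<open>Prime avoidance and associated primes\<close>

context noetherian_local_ring
begin

lemma ex_in_ideals_not_in_prime:
  assumes "finite \<G>" "primeideal P R" "ideal N R" "\<not> N \<subseteq> P" "\<And>Q. Q \<in> \<G> \<Longrightarrow> ideal Q R \<and> \<not> Q \<subseteq> P"
  shows "\<exists>y\<in>N. y \<notin> P \<and> (\<forall>Q\<in>\<G>. y \<in> Q)"
  using assms(1,5)
proof (induction \<G>)
  case empty
  then show ?case using assms(4) by auto
next
  case (insert Q \<G>)
  then obtain y where y: "y \<in> N" "y \<notin> P" "\<And>Q. Q \<in> \<G> \<Longrightarrow> y \<in> Q" by auto
  have Qi: "ideal Q R" and Gi: "\<And>Q'. Q' \<in> \<G> \<Longrightarrow> ideal Q' R" using insert.prems by auto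
  obtain q where q: "q \<in> Q" "q \<notin> P" using insert.prems by blast
  have qc: "q \<in> carrier R" using ideal_carrier[OF Qi q(1)] .
  have yc: "y \<in> carrier R" using ideal_carrier[OF assms(3) y(1)] .
  have "q \<otimes> y \<in> N" using ideal_mult[OF assms(3) qc y(1)] .
  moreover have "q \<otimes> y \<notin> P" using primeideal.I_prime[OF assms(2) qc yc] q y by blast
  moreover have "q \<otimes> y \<in> Q" using ideal_mult_right[OF Qi yc q(1)] .
  moreover have "q \<otimes> y \<in> Q'" if "Q' \<in> \<G>" for Q' using ideal_mult[OF Gi[OF that] qc y(3)[OF that]] .
  ultimately show ?case by blast
qed

text \<open>As the primes form an antichain, there is \<open>y \<in> N\<close> outside the new prime
  \<open>P\<close> but inside all earlier ones. If the element \<open>x\<close> found so far lies in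
  \<open>P\<close>, then \<open>x \<oplus> y\<close> avoids every prime.\<close>

lemma prime_avoidance:
  assumes "finite \<P>" "\<And>P. P \<in> \<P> \<Longrightarrow> primeideal P R" "\<And>P Q. P \<in> \<P> \<Longrightarrow> Q \<in> \<P> \<Longrightarrow> P \<subseteq> Q \<Longrightarrow> P = Q"
    and N: "ideal N R" and "\<And>P. P \<in> \<P> \<Longrightarrow> \<not> N \<subseteq> P"
  shows "\<exists>x\<in>N. \<forall>P\<in>\<P>. x \<notin> P"
  using assms(1-3,5)
proof (induction \<P>)
  case empty
  then show ?case using ideal_zero[OF N] by auto
next
  case (insert P \<F>)
  have "\<exists>x\<in>N. \<forall>Q\<in>\<F>. x \<notin> Q"
    by (rule insert.IH) (use insert.prems in auto)
  then obtain x where x: "x \<in> N" "\<And>Q. Q \<in> \<F> \<Longrightarrow> x \<notin> Q" by auto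
  have P: "primeideal P R" using insert.prems(1) by blast
  have Fi: "ideal Q R" if "Q \<in> \<F>" for Q using insert.prems(1) that primeideal.axioms(1) by blast
  have "\<not> Q \<subseteq> P" if "Q \<in> \<F>" for Q using insert.prems(2)[of Q P] insert.hyps(2) that by auto
  then have "\<exists>y\<in>N. y \<notin> P \<and> (\<forall>Q\<in>\<F>. y \<in> Q)"
    using Fi insert.prems(3)[of P] by (intro ex_in_ideals_not_in_prime[OF insert.hyps(1) P N]) auto
  then obtain y where y: "y \<in> N" "y \<notin> P" "\<And>Q. Q \<in> \<F> \<Longrightarrow> y \<in> Q" by blast
  show ?case
  proof (cases "x \<in> P")
    case False
    then show ?thesis using x by blast
  next
    case True
    have xc: "x \<in> carrier R" and yc: "y \<in> carrier R" using ideal_carrier[OF N] x(1) y(1) by auto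
    have "x \<oplus> y \<notin> P" using ideal_add_cancel[OF primeideal.axioms(1)[OF P], of x y] True y(2) yc by blast
    moreover have "x \<oplus> y \<notin> Q" if "Q \<in> \<F>" for Q
    proof
      assume "x \<oplus> y \<in> Q"
      then have "y \<oplus> x \<in> Q" using a_comm[OF xc yc] by simp
      then have "x \<in> Q" by (rule ideal_add_cancel[OF Fi[OF that] _ y(3)[OF that] xc])
      then show False using x(2)[OF that] by blast
    qed
    moreover have "x \<oplus> y \<in> N" by (rule ideal_add[OF N x(1) y(1)])
    ultimately show ?thesis by blast
  qed
qed

text \<open>The factor \<open>carrier R\<close> makes the empty family intersect to the whole ring,
  which no prime contains.\<close>

lemma prime_contains_Inter:
  assumes "finite \<F>" "\<And>Q. Q \<in> \<F> \<Longrightarrow> ideal Q R" "primeideal P R" "carrier R \<inter> \<Inter>\<F> \<subseteq> P"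
  shows "\<exists>Q\<in>\<F>. Q \<subseteq> P"
  using assms(1,2,4)
proof (induction \<F>)
  case empty
  then show ?case using primeideal.I_notcarr[OF assms(3)] ideal_carrier[OF primeideal.axioms(1)[OF assms(3)]] by auto
next
  case (insert Q \<F>)
  show ?case
  proof (cases "Q \<subseteq> P")
    case False
    then obtain q where q: "q \<in> Q" "q \<notin> P" by blast
    have Qi: "ideal Q R" using insert by blast
    have qc: "q \<in> carrier R" using ideal_carrier[OF Qi q(1)] .
    have "carrier R \<inter> \<Inter>\<F> \<subseteq> P"
    proof
      fix r assume r: "r \<in> carrier R \<inter> \<Inter>\<F>"
      have "q \<otimes> r \<in> Q'" if "Q' \<in> \<F>" for Q'
        using ideal_mult[of Q' q r] that insert.prems(1) r qc by blast
      moreover have "q \<otimes> r \<in> Q" using ideal_mult_right[OF Qi _ q(1)] r by blast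
      ultimately have "q \<otimes> r \<in> P" using insert.prems(2) r qc by blast
      then show "r \<in> P" using primeideal.I_prime[OF assms(3) qc] r q by blast
    qed
    then show ?thesis using insert by blast
  qed blast
qed

text \<open>Every zero divisor modulo \<open>J\<close> lies in a maximal annihilator
  \<open>J : w\<close>, which is prime. If \<open>N\<close> were contained in it, \<open>w\<close>
  would belong to \<open>J : N\<close> but not to \<open>J\<close>. Since only finitely many such
  primes occur, prime avoidance applies.\<close>

lemma ex_nonzerodivisor_mod:
  assumes J: "ideal J R" and N: "ideal N R" and soc: "ideal_colon R J N \<subseteq> J"
  shows "\<exists>x\<in>N. nonzerodivisor_mod R J x"
proof -
  define Z where "Z = {w \<in> carrier R - J. \<forall>v\<in>carrier R - J.
    ideal_colon R J {w} \<subseteq> ideal_colon R J {v} \<longrightarrow> ideal_colon R J {v} = ideal_colon R J {w}}"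
  have Zc: "Z \<subseteq> carrier R" by (auto simp: Z_def)
  have prime: "primeideal (ideal_colon R J {w}) R" if "w \<in> Z" for w
    using that by (intro maximal_colon_prime[OF J]) (auto simp: Z_def)
  \<comment> \<open>Finiteness of the set of primes: a maximal ideal of this family is generated by
    a finite \<open>F \<subseteq> Z\<close> and contains all of \<open>Z\<close>. What annihilates
    \<open>F\<close> modulo \<open>J\<close> annihilates every \<open>w \<in> Z\<close>, so the
    prime \<open>J : w\<close> contains some \<open>J : f\<close> and equals it by
    maximality.\<close>
  let ?S = "{Idl F | F. finite F \<and> F \<subseteq> Z}"
  have ne: "?S \<noteq> {}" by blast
  obtain M where M: "M \<in> ?S" and max: "\<And>K. K \<in> ?S \<Longrightarrow> M \<subseteq> K \<Longrightarrow> K = M"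
    by (rule ex_maximal_ideal_in[OF ne]) (use Zc genideal_ideal in auto)
  obtain F where F: "finite F" "F \<subseteq> Z" "M = Idl F" using M by blast
  have Fc: "F \<subseteq> carrier R" using F Zc by blast
  have ZM: "Z \<subseteq> Idl F"
  proof
    fix w assume w: "w \<in> Z"
    then have "insert w F \<subseteq> carrier R" using Zc F by blast
    then have sub: "insert w F \<subseteq> Idl (insert w F)" by (rule genideal_self)
    have "Idl F \<subseteq> Idl (insert w F)"
      using sub \<open>insert w F \<subseteq> carrier R\<close> by (intro genideal_minimal genideal_ideal) auto
    then have "Idl (insert w F) = Idl F" using max[of "Idl (insert w F)"] F w by auto
    then show "w \<in> Idl F" using sub by blast
  qed
  let ?\<P> = "(\<lambda>w. ideal_colon R J {w}) ` F"
  have colF: "ideal_colon R J {w} \<in> ?\<P>" if w: "w \<in> Z" for w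
  proof -
    have "carrier R \<inter> \<Inter>?\<P> \<subseteq> ideal_colon R J {w}"
    proof
      fix r assume r: "r \<in> carrier R \<inter> \<Inter>?\<P>"
      then have rc: "r \<in> carrier R" by blast
      have "F \<subseteq> ideal_colon R J {r}" using r Fc by (auto simp: ideal_colon_singleton m_comm subset_iff)
      then have "Idl F \<subseteq> ideal_colon R J {r}"
        using rc by (intro genideal_minimal ideal_colon_ideal[OF J]) auto
      then show "r \<in> ideal_colon R J {w}"
        using w ZM Zc rc by (auto simp: ideal_colon_singleton m_comm subset_iff)
    qed
    moreover have "ideal Q R" if "Q \<in> ?\<P>" for Q using that ideal_colon_ideal[OF J] Fc by auto
    ultimately have "\<exists>Q\<in>?\<P>. Q \<subseteq> ideal_colon R J {w}"
      using prime_contains_Inter[of ?\<P> "ideal_colon R J {w}"] F prime[OF w] by blast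
    then obtain f where f: "f \<in> F" "ideal_colon R J {f} \<subseteq> ideal_colon R J {w}" by blast
    then have "ideal_colon R J {w} = ideal_colon R J {f}" using F(2) w unfolding Z_def by blast
    then show ?thesis using f by blast
  qed
  have "\<exists>x\<in>N. \<forall>P\<in>?\<P>. x \<notin> P"
  proof (rule prime_avoidance[OF _ _ _ N])
    show "finite ?\<P>" using F by simp
    show "primeideal P R" if "P \<in> ?\<P>" for P using that prime F by blast
    show "P = Q" if "P \<in> ?\<P>" "Q \<in> ?\<P>" "P \<subseteq> Q" for P Q
      using that F(2) unfolding Z_def by blast
    show "\<not> N \<subseteq> P" if P: "P \<in> ?\<P>" for P
    proof
      assume "N \<subseteq> P"
      obtain f where f: "f \<in> F" "P = ideal_colon R J {f}" using P by blast
      then have fz: "f \<in> carrier R" "f \<notin> J" using F(2) by (auto simp: Z_def)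
      have "f \<otimes> a \<in> J" if "a \<in> N" for a
      proof -
        have a: "a \<in> ideal_colon R J {f}" using \<open>N \<subseteq> P\<close> f that by blast
        then show ?thesis using m_comm[of f a] fz by (simp add: ideal_colon_singleton)
      qed
      then have "f \<in> ideal_colon R J N" using fz by (simp add: ideal_colon_def)
      then show False using soc fz by blast
    qed
  qed
  then obtain x where x: "x \<in> N" "\<And>P. P \<in> ?\<P> \<Longrightarrow> x \<notin> P" by blast
  have xc: "x \<in> carrier R" using x ideal_carrier[OF N] by blast
  have "y \<in> J" if y: "y \<in> carrier R" "x \<otimes> y \<in> J" for y
  proof (rule ccontr)
    assume "y \<notin> J"
    then obtain w where w: "w \<in> Z" "ideal_colon R J {y} \<subseteq> ideal_colon R J {w}"
      using ex_maximal_colon[OF J, of y] y unfolding Z_def by blast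
    have "x \<in> ideal_colon R J {y}" using xc y by (simp add: ideal_colon_singleton)
    then show False using x(2)[OF colF[OF w(1)]] w(2) by blast
  qed
  then show ?thesis using x(1) unfolding nonzerodivisor_mod_def by blast
qed

end

section \<open>Principal ideals and quotients of depth two or three\<close>

context local_ring_three_generators
begin

text \<open>Dividing \<open>s \<otimes> z\<close>, \<open>t \<otimes> z\<close> and
  \<open>u \<otimes> z\<close> by \<open>b\<close> gives a vector parallel to
  \<open>(s, t, u)\<close>. By \<open>koszul2\<close> it is \<open>w\<close> times that vector, and
  then \<open>z = w \<otimes> b\<close>.\<close>

lemma koszul_zero_principal:
  assumes b: "b \<in> carrier R" "b \<noteq> \<zero>" and z: "z \<in> carrier R"
    and k: "s \<otimes> z \<in> PIdl b" "t \<otimes> z \<in> PIdl b" "u \<otimes> z \<in> PIdl b"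
  shows "z \<in> PIdl b"
proof -
  obtain c1 c2 c3 where c: "c1 \<in> carrier R" "c2 \<in> carrier R" "c3 \<in> carrier R"
    "s \<otimes> z = c1 \<otimes> b" "t \<otimes> z = c2 \<otimes> b" "u \<otimes> z = c3 \<otimes> b"
    using k by (auto simp: cgenideal_def)
  have cross: "d \<otimes> e' = d' \<otimes> e" if "d \<in> carrier R" "d' \<in> carrier R" "e \<in> carrier R" "e' \<in> carrier R"
    "d \<otimes> z = e \<otimes> b" "d' \<otimes> z = e' \<otimes> b" for d d' e e'
  proof -
    have "(d \<otimes> e') \<otimes> b = d \<otimes> (d' \<otimes> z)" unfolding that(6) using that b by (simp add: m_assoc)
    also have "\<dots> = d' \<otimes> (d \<otimes> z)" using that(1,2) z by (simp add: m_lcomm)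
    also have "\<dots> = (d' \<otimes> e) \<otimes> b" unfolding that(5) using that b by (simp add: m_assoc)
    finally show ?thesis using m_rcancel[OF b(2,1)] that by auto
  qed
  obtain w where w: "w \<in> carrier R" "c1 = s \<otimes> w"
    by (rule koszul2[OF c(1-3) cross[OF stu(1,2) c(1,2,4,5)] cross[OF stu(1,3) c(1,3,4,6)]
      cross[OF stu(2,3) c(2,3,5,6)]])
  have "s \<otimes> z = s \<otimes> (w \<otimes> b)" using c(4) w b by (simp add: m_assoc)
  then have "z = w \<otimes> b" using m_lcancel[OF s_nonzero, of z "w \<otimes> b"] w b z by auto
  then show ?thesis using w by (auto simp: cgenideal_def)
qed

text \<open>The minors divided by \<open>h\<close> form, up to sign, a vector orthogonal to
  \<open>(s, t, u)\<close>, which \<open>koszul1\<close> writes as a cross product with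
  \<open>(a', b', c')\<close>. Subtracting \<open>h\<close> times \<open>(a', b', c')\<close> from
  \<open>(a, b, c)\<close> makes the minors vanish, and \<open>koszul2\<close> applies.\<close>

lemma koszul2_principal:
  assumes h: "h \<in> carrier R" "h \<noteq> \<zero>"
    and abc: "a \<in> carrier R" "b \<in> carrier R" "c \<in> carrier R"
    and rel: "s \<otimes> b \<ominus> t \<otimes> a \<in> PIdl h" "s \<otimes> c \<ominus> u \<otimes> a \<in> PIdl h" "t \<otimes> c \<ominus> u \<otimes> b \<in> PIdl h"
  obtains z where "z \<in> carrier R" "a \<ominus> s \<otimes> z \<in> PIdl h" "b \<ominus> t \<otimes> z \<in> PIdl h" "c \<ominus> u \<otimes> z \<in> PIdl h"
proof -
  obtain p q r where pqr: "p \<in> carrier R" "q \<in> carrier R" "r \<in> carrier R"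
    "t \<otimes> c \<ominus> u \<otimes> b = p \<otimes> h" "s \<otimes> c \<ominus> u \<otimes> a = q \<otimes> h" "s \<otimes> b \<ominus> t \<otimes> a = r \<otimes> h"
    using rel by (auto simp: cgenideal_def)
  have "(s \<otimes> p \<oplus> t \<otimes> (\<ominus> q) \<oplus> u \<otimes> r) \<otimes> h = s \<otimes> (p \<otimes> h) \<ominus> t \<otimes> (q \<otimes> h) \<oplus> u \<otimes> (r \<otimes> h)"
    using pqr(1-3) h(1) stu by algebra
  also have "\<dots> = \<zero>" unfolding pqr(4-6)[symmetric] using abc stu by algebra
  finally have "s \<otimes> p \<oplus> t \<otimes> (\<ominus> q) \<oplus> u \<otimes> r = \<zero>"
    using integral[of "s \<otimes> p \<oplus> t \<otimes> (\<ominus> q) \<oplus> u \<otimes> r" h] pqr h by auto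
  then obtain a' b' c' where a': "a' \<in> carrier R" "b' \<in> carrier R" "c' \<in> carrier R"
    "p = t \<otimes> c' \<ominus> u \<otimes> b'" "\<ominus> q = u \<otimes> a' \<ominus> s \<otimes> c'" "r = s \<otimes> b' \<ominus> t \<otimes> a'"
    by (rule koszul1[OF pqr(1) a_inv_closed[OF pqr(2)] pqr(3)])
  have q: "q = s \<otimes> c' \<ominus> u \<otimes> a'"
  proof -
    have "q = \<ominus> (\<ominus> q)" using pqr by simp
    also have "\<dots> = s \<otimes> c' \<ominus> u \<otimes> a'" unfolding a'(5) using a'(1-3) stu by algebra
    finally show ?thesis .
  qed
  have cross: "d \<otimes> (e' \<ominus> f' \<otimes> h) = d' \<otimes> (e \<ominus> f \<otimes> h)"
    if "d \<in> carrier R" "d' \<in> carrier R" "e \<in> carrier R" "e' \<in> carrier R" "f \<in> carrier R" "f' \<in> carrier R"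
      "g = d \<otimes> f' \<ominus> d' \<otimes> f" "d \<otimes> e' \<ominus> d' \<otimes> e = g \<otimes> h" for d d' e e' f f' g
  proof -
    have "d \<otimes> (e' \<ominus> f' \<otimes> h) = (d \<otimes> e' \<ominus> d' \<otimes> e) \<oplus> d' \<otimes> e \<ominus> d \<otimes> f' \<otimes> h"
      using that(1-6) h(1) by algebra
    also have "\<dots> = d' \<otimes> (e \<ominus> f \<otimes> h)" unfolding that(8) that(7) using that(1-6) h(1) by algebra
    finally show ?thesis .
  qed
  have closed: "a \<ominus> a' \<otimes> h \<in> carrier R" "b \<ominus> b' \<otimes> h \<in> carrier R" "c \<ominus> c' \<otimes> h \<in> carrier R"
    using abc a' h by auto
  obtain z where z: "z \<in> carrier R" "a \<ominus> a' \<otimes> h = s \<otimes> z" "b \<ominus> b' \<otimes> h = t \<otimes> z" "c \<ominus> c' \<otimes> h = u \<otimes> z"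
    by (rule koszul2[OF closed cross[OF stu(1,2) abc(1,2) a'(1,2) a'(6) pqr(6)]
      cross[OF stu(1,3) abc(1,3) a'(1,3) q pqr(5)] cross[OF stu(2,3) abc(2,3) a'(2,3,4) pqr(4)]])
  have "e \<ominus> d \<otimes> z \<in> PIdl h" if "e \<in> carrier R" "d \<in> carrier R" "e' \<in> carrier R" "e \<ominus> e' \<otimes> h = d \<otimes> z" for e d e'
  proof -
    have "e \<ominus> d \<otimes> z = e' \<otimes> h" unfolding that(4)[symmetric] using that(1-3) h(1) by algebra
    then show ?thesis using that by (auto simp: cgenideal_def)
  qed
  note mem = this
  show ?thesis
    by (rule that[OF z(1) mem[OF abc(1) stu(1) a'(1) z(2)] mem[OF abc(2) stu(2) a'(2) z(3)]
      mem[OF abc(3) stu(3) a'(3) z(4)]])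
qed

text \<open>A socle element \<open>z\<close> modulo \<open>b, x\<close> has
  \<open>s \<otimes> z\<close>, \<open>t \<otimes> z\<close>, \<open>u \<otimes> z\<close> congruent
  to multiples \<open>c1, c2, c3\<close> of \<open>x\<close> modulo \<open>b\<close>. Cancelling
  \<open>x\<close> puts the minors of \<open>(c1, c2, c3)\<close> into \<open>(b)\<close>, so
  \<open>koszul2_principal\<close> yields \<open>w\<close>. Then
  \<open>z \<ominus> w \<otimes> x\<close> is a socle element modulo \<open>b\<close>, hence lies in
  \<open>(b)\<close>.\<close>

lemma principal_regular_pair:
  assumes b: "b \<in> carrier R" "b \<noteq> \<zero>"
  obtains x y where "x \<in> m" "nonzerodivisor_mod R (PIdl b) x" "y \<in> m"
    "nonzerodivisor_mod R (PIdl b <+>\<^bsub>R\<^esub> PIdl x) y"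
proof -
  have bi: "ideal (PIdl b) R" using b by (simp add: cgenideal_ideal)
  have "ideal_colon R (PIdl b) m \<subseteq> PIdl b"
  proof
    fix z assume z: "z \<in> ideal_colon R (PIdl b) m"
    then have zc: "z \<in> carrier R" by (simp add: ideal_colon_def)
    have "a \<otimes> z \<in> PIdl b" if "a \<in> m" for a
      using z that m_comm[of z a] m_carrier[OF that] by (auto simp: ideal_colon_def)
    then show "z \<in> PIdl b" using koszul_zero_principal[OF b zc] s_in_m t_in_m u_in_m by blast
  qed
  then obtain x where x: "x \<in> m" "nonzerodivisor_mod R (PIdl b) x"
    using ex_nonzerodivisor_mod[OF bi m_ideal] by blast
  have xc: "x \<in> carrier R" using m_carrier[OF x(1)] .
  let ?J = "PIdl b <+>\<^bsub>R\<^esub> PIdl x"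
  have Ji: "ideal ?J R" by (rule add_PIdl_ideal[OF bi xc])
  have "ideal_colon R ?J m \<subseteq> ?J"
  proof
    fix z assume z: "z \<in> ideal_colon R ?J m"
    then have zc: "z \<in> carrier R" by (simp add: ideal_colon_def)
    have ex: "\<exists>c\<in>carrier R. a \<otimes> z \<ominus> c \<otimes> x \<in> PIdl b" if "a \<in> m" for a
    proof -
      have "a \<otimes> z \<in> ?J" using z that m_comm[of z a] m_carrier[OF that] by (auto simp: ideal_colon_def)
      then show ?thesis using add_PIdlE[OF _ bi xc] by metis
    qed
    obtain c1 c2 c3 where c: "c1 \<in> carrier R" "c2 \<in> carrier R" "c3 \<in> carrier R"
      "s \<otimes> z \<ominus> c1 \<otimes> x \<in> PIdl b" "t \<otimes> z \<ominus> c2 \<otimes> x \<in> PIdl b" "u \<otimes> z \<ominus> c3 \<otimes> x \<in> PIdl b"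
      using ex[OF s_in_m] ex[OF t_in_m] ex[OF u_in_m] by blast
    have cross: "d \<otimes> e' \<ominus> d' \<otimes> e \<in> PIdl b" if "d \<in> carrier R" "d' \<in> carrier R" "e \<in> carrier R" "e' \<in> carrier R"
      "d \<otimes> z \<ominus> e \<otimes> x \<in> PIdl b" "d' \<otimes> z \<ominus> e' \<otimes> x \<in> PIdl b" for d d' e e'
    proof -
      have "x \<otimes> (d \<otimes> e' \<ominus> d' \<otimes> e) = d' \<otimes> (d \<otimes> z \<ominus> e \<otimes> x) \<ominus> d \<otimes> (d' \<otimes> z \<ominus> e' \<otimes> x)"
        using that(1-4) xc zc by algebra
      also have "\<dots> \<in> PIdl b" by (rule ideal_comb2_minus[OF bi]) (use that in auto)
      finally show ?thesis using nonzerodivisor_modD[OF x(2)] that by auto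
    qed
    obtain w where w: "w \<in> carrier R" "c1 \<ominus> s \<otimes> w \<in> PIdl b" "c2 \<ominus> t \<otimes> w \<in> PIdl b" "c3 \<ominus> u \<otimes> w \<in> PIdl b"
      by (rule koszul2_principal[OF b c(1-3) cross[OF stu(1,2) c(1,2,4,5)] cross[OF stu(1,3) c(1,3,4,6)]
        cross[OF stu(2,3) c(2,3,5,6)]])
    have step: "d \<otimes> (z \<ominus> w \<otimes> x) \<in> PIdl b" if "d \<in> carrier R" "e \<in> carrier R"
      "d \<otimes> z \<ominus> e \<otimes> x \<in> PIdl b" "e \<ominus> d \<otimes> w \<in> PIdl b" for d e
    proof -
      have "d \<otimes> (z \<ominus> w \<otimes> x) = \<one> \<otimes> (d \<otimes> z \<ominus> e \<otimes> x) \<oplus> x \<otimes> (e \<ominus> d \<otimes> w)"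
        using that(1,2) w(1) xc zc by algebra
      also have "\<dots> \<in> PIdl b" by (rule ideal_comb2[OF bi]) (use that xc in auto)
      finally show ?thesis .
    qed
    have "z \<ominus> w \<otimes> x \<in> PIdl b"
      by (rule koszul_zero_principal[OF b]) (use step[OF stu(1) c(1,4) w(2)] step[OF stu(2) c(2,5) w(3)]
        step[OF stu(3) c(3,6) w(4)] w zc xc in auto)
    then show "z \<in> ?J" by (rule add_PIdlI[OF bi xc w(1) zc])
  qed
  then obtain y where "y \<in> m" "nonzerodivisor_mod R ?J y"
    using ex_nonzerodivisor_mod[OF Ji m_ideal] by blast
  then show ?thesis using that x by blast
qed

lemma ideal_prod_mE:
  assumes J: "ideal J R" and "x \<in> ideal_prod R m J"
  shows "\<exists>p\<in>J. \<exists>q\<in>J. \<exists>r\<in>J. x = s \<otimes> p \<oplus> t \<otimes> q \<oplus> u \<otimes> r"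
  using assms(2)
proof (induction x rule: ideal_prod.induct)
  case (prod i j)
  obtain a b c where abc: "a \<in> carrier R" "b \<in> carrier R" "c \<in> carrier R" "i = s \<otimes> a \<oplus> t \<otimes> b \<oplus> u \<otimes> c"
    using mE[OF prod(1)] .
  have jc: "j \<in> carrier R" using ideal_carrier[OF J prod(2)] .
  have "i \<otimes> j = s \<otimes> (a \<otimes> j) \<oplus> t \<otimes> (b \<otimes> j) \<oplus> u \<otimes> (c \<otimes> j)"
    unfolding abc(4) using abc(1-3) jc stu by algebra
  then show ?case using ideal_mult[OF J _ prod(2)] abc by blast
next
  case (sum s1 s2)
  then obtain p q r p' q' r' where pq: "p \<in> J" "q \<in> J" "r \<in> J" "p' \<in> J" "q' \<in> J" "r' \<in> J"
    and eq: "s1 = s \<otimes> p \<oplus> t \<otimes> q \<oplus> u \<otimes> r" "s2 = s \<otimes> p' \<oplus> t \<otimes> q' \<oplus> u \<otimes> r'" by blast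
  have "s1 \<oplus> s2 = s \<otimes> (p \<oplus> p') \<oplus> t \<otimes> (q \<oplus> q') \<oplus> u \<otimes> (r \<oplus> r')"
    unfolding eq using pq[THEN ideal_carrier[OF J]] stu by algebra
  then show ?case using pq ideal_add[OF J] by blast
qed

text \<open>The coefficient vector of \<open>g \<in> J\<close> is a cross product with
  \<open>(s, t, u)\<close> modulo \<open>J\<close>, by \<open>koszul1_mod\<close>. The cross product
  contributes nothing to \<open>g\<close>, so only a term in \<open>mJ\<close> remains and
  \<open>J = mJ\<close>.\<close>

lemma regular_triple_zero:
  assumes J: "ideal J R" "J \<subseteq> m" and x: "x \<in> m" "nonzerodivisor_mod R J x"
    and y: "y \<in> m" "nonzerodivisor_mod R (J <+>\<^bsub>R\<^esub> PIdl x) y"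
    and v: "v \<in> m" "nonzerodivisor_mod R ((J <+>\<^bsub>R\<^esub> PIdl x) <+>\<^bsub>R\<^esub> PIdl y) v"
  shows "J = {\<zero>}"
proof (rule Nakayama[OF J(1) zeroideal])
  show "{\<zero>} \<subseteq> J" using ideal_zero[OF J(1)] by simp
  fix K g assume K: "ideal K R" "\<And>a y. a \<in> m \<Longrightarrow> y \<in> J \<Longrightarrow> a \<otimes> y \<in> K" and g: "g \<in> J"
  obtain p q r where pqr: "p \<in> carrier R" "q \<in> carrier R" "r \<in> carrier R" "g = s \<otimes> p \<oplus> t \<otimes> q \<oplus> u \<otimes> r"
    using mE g J(2) by blast
  obtain a b c where abc: "a \<in> carrier R" "b \<in> carrier R" "c \<in> carrier R"
    "p \<ominus> (t \<otimes> c \<ominus> u \<otimes> b) \<in> J" "q \<ominus> (u \<otimes> a \<ominus> s \<otimes> c) \<in> J" "r \<ominus> (s \<otimes> b \<ominus> t \<otimes> a) \<in> J"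
    by (rule koszul1_mod[OF J(1) x y v pqr(1-3) g[unfolded pqr(4)]])
  have "g = s \<otimes> (p \<ominus> (t \<otimes> c \<ominus> u \<otimes> b)) \<oplus> t \<otimes> (q \<ominus> (u \<otimes> a \<ominus> s \<otimes> c)) \<oplus> u \<otimes> (r \<ominus> (s \<otimes> b \<ominus> t \<otimes> a))"
    unfolding pqr(4) using pqr(1-3) abc(1-3) stu by algebra
  also have "\<dots> \<in> K"
    by (intro ideal_add[OF K(1)] K(2) s_in_m t_in_m u_in_m abc(4-6))
  finally show "g \<in> K" .
qed

text \<open>\<open>J'\<close> is maximal among the proper subideals of \<open>J\<close> with \<open>J' \<inter> mJ \<subseteq> mJ'\<close>; it is spanned by
  all but one element \<open>f\<close> of a minimal system of generators of \<open>J\<close>.\<close>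

lemma ex_pure_complement:
  assumes J: "ideal J R" "J \<noteq> {\<zero>}"
  obtains J' f where "ideal J' R" "J' \<subseteq> J" "f \<in> J" "f \<notin> J'" "J = J' <+>\<^bsub>R\<^esub> PIdl f"
    "J' \<inter> ideal_prod R m J \<subseteq> ideal_prod R m J'"
proof -
  let ?mJ = "ideal_prod R m J"
  have mJ: "ideal ?mJ R" using ideal_prod_is_ideal[OF m_ideal J(1)] .
  have mJJ: "?mJ \<subseteq> J" using ideal_prod_inter[OF m_ideal J(1)] by blast
  let ?S = "{K. ideal K R \<and> K \<subset> J \<and> K \<inter> ?mJ \<subseteq> ideal_prod R m K}"
  have "\<zero> \<in> ideal_prod R m {\<zero>}" using ideal_zero[OF ideal_prod_is_ideal[OF m_ideal zeroideal]] .
  then have "{\<zero>} \<in> ?S" using J ideal_zero[OF J(1)] zeroideal by auto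
  then have ne: "?S \<noteq> {}" by blast
  obtain J' where J': "J' \<in> ?S" and max: "\<And>K. K \<in> ?S \<Longrightarrow> J' \<subseteq> K \<Longrightarrow> K = J'"
    by (rule ex_maximal_ideal_in[OF ne]) auto
  have J'i: "ideal J' R" and J'J: "J' \<subseteq> J" "J' \<noteq> J" and J'p: "J' \<inter> ?mJ \<subseteq> ideal_prod R m J'"
    using J' by auto
  have "\<exists>f\<in>J. f \<notin> J' <+>\<^bsub>R\<^esub> ?mJ"
  proof (rule ccontr)
    assume neg: "\<not> ?thesis"
    have "J = J'"
    proof (rule Nakayama[OF J(1) J'i J'J(1)])
      fix K x assume K: "ideal K R" "J' \<subseteq> K" "\<And>a y. a \<in> m \<Longrightarrow> y \<in> J \<Longrightarrow> a \<otimes> y \<in> K" and x: "x \<in> J"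
      obtain j l where jl: "j \<in> J'" "l \<in> ?mJ" "x = j \<oplus> l" using neg x by (auto simp: set_add_def')
      have "y \<in> K" if "y \<in> ?mJ" for y
        using that by (induction y rule: ideal_prod.induct) (auto intro: K(3) ideal_add[OF K(1)])
      then show "x \<in> K" unfolding jl(3) using jl K(2) by (intro ideal_add[OF K(1)]) auto
    qed
    then show False using J'J by blast
  qed
  then obtain f where f: "f \<in> J" "f \<notin> J' <+>\<^bsub>R\<^esub> ?mJ" by blast
  have fc: "f \<in> carrier R" using ideal_carrier[OF J(1) f(1)] .
  have sumI: "j \<oplus> l \<in> J' <+>\<^bsub>R\<^esub> ?mJ" if "j \<in> J'" "l \<in> ?mJ" for j l
    using that by (auto simp: set_add_def')
  have J'sum: "j \<in> J' <+>\<^bsub>R\<^esub> ?mJ" if "j \<in> J'" for j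
    using sumI[OF that ideal_zero[OF mJ]] ideal_carrier[OF J'i that] by simp
  have sumi: "ideal (J' <+>\<^bsub>R\<^esub> ?mJ) R" by (rule add_ideals[OF J'i mJ])
  have fJ': "f \<notin> J'" using J'sum f(2) by blast
  let ?K = "J' <+>\<^bsub>R\<^esub> PIdl f"
  have Ki: "ideal ?K R" by (rule add_PIdl_ideal[OF J'i fc])
  have KJ: "?K \<subseteq> J" using J'J f(1) by (auto simp: in_add_PIdl_iff intro!: ideal_add[OF J(1)] ideal_mult[OF J(1)])
  have mJ'K: "ideal_prod R m J' \<subseteq> ideal_prod R m ?K"
  proof
    fix y assume "y \<in> ideal_prod R m J'"
    then show "y \<in> ideal_prod R m ?K"
      by (induction y rule: ideal_prod.induct)
        (use subset_add_PIdl[OF J'i fc] in \<open>auto intro: ideal_prod.intros\<close>)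
  qed
  \<comment> \<open>Adjoining \<open>f\<close> keeps the intersection property, so maximality of
    \<open>J'\<close> leaves only \<open>?K = J\<close>. The coefficient of \<open>f\<close> must
    lie in \<open>m\<close>, since a unit would put \<open>f\<close> into
    \<open>J' + mJ\<close>.\<close>
  have "?K \<inter> ?mJ \<subseteq> ideal_prod R m ?K"
  proof
    fix y assume y: "y \<in> ?K \<inter> ?mJ"
    then obtain j r where jr: "j \<in> J'" "r \<in> carrier R" "y = j \<oplus> r \<otimes> f" by (auto simp: in_add_PIdl_iff)
    have jc: "j \<in> carrier R" using ideal_carrier[OF J'i jr(1)] .
    have rm: "r \<in> m"
    proof (rule ccontr)
      assume "r \<notin> m"
      moreover have "r \<otimes> f \<in> J' <+>\<^bsub>R\<^esub> ?mJ"
      proof (rule ideal_add_cancel[OF sumi _ J'sum[OF jr(1)]])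
        have "y = \<zero> \<oplus> y" using jr jc fc by simp
        then show "j \<oplus> r \<otimes> f \<in> J' <+>\<^bsub>R\<^esub> ?mJ" using sumI[OF ideal_zero[OF J'i], of y] y jr(3) by auto
      qed (use jr fc in auto)
      ultimately have "f \<in> J' <+>\<^bsub>R\<^esub> ?mJ" using saturated_atD[OF ideal_saturated[OF sumi]] jr fc by blast
      then show False using f by blast
    qed
    have "r \<otimes> f \<in> ?mJ" using rm f(1) by (rule ideal_prod.prod)
    then have "j \<in> ?mJ" using ideal_add_cancel[OF mJ, of "r \<otimes> f" j] y jr jc fc a_comm[of j "r \<otimes> f"] by auto
    then have "j \<in> ideal_prod R m ?K" using J'p jr(1) mJ'K by blast
    moreover have "r \<otimes> f \<in> ideal_prod R m ?K" using rm elem_add_PIdl[OF J'i fc] by (rule ideal_prod.prod)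
    ultimately show "y \<in> ideal_prod R m ?K" unfolding jr(3) by (rule ideal_prod.sum)
  qed
  then have "?K = J"
    using max[of ?K] Ki KJ subset_add_PIdl[OF J'i fc] elem_add_PIdl[OF J'i fc] fJ' by blast
  then show ?thesis using that J'i J'J(1) f(1) fJ' J'p by blast
qed

text \<open>The coefficients of \<open>f\<close> in the relations with the other generators form an ideal \<open>L = J' : f\<close>.
  Vanishing of the first Koszul homology of \<open>J\<close> gives \<open>L = mL\<close>, so \<open>L = 0\<close>, while \<open>J' \<subseteq> L\<close>.\<close>

lemma regular_pair_principal:
  assumes J: "ideal J R" and x: "x \<in> m" "nonzerodivisor_mod R J x"
    and y: "y \<in> m" "nonzerodivisor_mod R (J <+>\<^bsub>R\<^esub> PIdl x) y"
  shows "\<exists>f\<in>carrier R. J = PIdl f"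
proof (cases "J = {\<zero>}")
  case True
  then have "J = PIdl \<zero>" using cgenideal_self[of \<zero>] by (auto simp: cgenideal_def)
  then show ?thesis by blast
next
  case False
  obtain J' f where J': "ideal J' R" "J' \<subseteq> J" and f: "f \<in> J" "f \<notin> J'"
    and JJ': "J = J' <+>\<^bsub>R\<^esub> PIdl f" and pure: "J' \<inter> ideal_prod R m J \<subseteq> ideal_prod R m J'"
    by (rule ex_pure_complement[OF J False])
  have fc: "f \<in> carrier R" using ideal_carrier[OF J f(1)] .
  let ?L = "ideal_colon R J' {f}"
  have Li: "ideal ?L R" using ideal_colon_ideal[OF J'(1)] fc by simp
  have "?L = {\<zero>}"
  proof (rule Nakayama[OF Li zeroideal])
    show "{\<zero>} \<subseteq> ?L" using ideal_zero[OF Li] by simp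
    fix K g assume K: "ideal K R" "\<And>a y. a \<in> m \<Longrightarrow> y \<in> ?L \<Longrightarrow> a \<otimes> y \<in> K" and g: "g \<in> ?L"
    then have gc: "g \<in> carrier R" and gf: "g \<otimes> f \<in> J'" by (auto simp: ideal_colon_singleton)
    have gm: "g \<in> m" using saturated_atD[OF ideal_saturated[OF J'(1)] gc _ fc gf] f(2) by blast
    obtain p q r where pqr: "p \<in> carrier R" "q \<in> carrier R" "r \<in> carrier R" "g = s \<otimes> p \<oplus> t \<otimes> q \<oplus> u \<otimes> r"
      using mE[OF gm] .
    \<comment> \<open>This is where the choice of \<open>J'\<close> enters:
      \<open>g \<otimes> f\<close> is expanded with coefficients in \<open>J'\<close>. Comparison
      with the expansion of \<open>g\<close> gives a relation among \<open>s, t, u\<close> with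
      entries in \<open>J\<close>.\<close>
    have "g \<otimes> f \<in> ideal_prod R m J'" using pure gf ideal_prod.prod[OF gm f(1)] by blast
    then obtain p' q' r' where p': "p' \<in> J'" "q' \<in> J'" "r' \<in> J'" "g \<otimes> f = s \<otimes> p' \<oplus> t \<otimes> q' \<oplus> u \<otimes> r'"
      using ideal_prod_mE[OF J'(1)] by blast
    note p'c = p'(1-3)[THEN ideal_carrier[OF J'(1)]]
    have inJ: "d \<otimes> f \<ominus> e \<in> J" if "d \<in> carrier R" "e \<in> J'" for d e
      using that J'(2) by (intro ideal_minus[OF J] ideal_mult[OF J] f(1)) auto
    let ?p = "p \<otimes> f \<ominus> p'" and ?q = "q \<otimes> f \<ominus> q'" and ?r = "r \<otimes> f \<ominus> r'"
    have cl: "?p \<in> carrier R" "?q \<in> carrier R" "?r \<in> carrier R" using pqr p'c fc by auto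
    have "s \<otimes> ?p \<oplus> t \<otimes> ?q \<oplus> u \<otimes> ?r = g \<otimes> f \<ominus> (s \<otimes> p' \<oplus> t \<otimes> q' \<oplus> u \<otimes> r')"
      unfolding pqr(4) using pqr(1-3) p'c fc stu by algebra
    also have "\<dots> = \<zero>" unfolding p'(4)[symmetric] using gc fc by algebra
    finally have rel: "s \<otimes> ?p \<oplus> t \<otimes> ?q \<oplus> u \<otimes> ?r = \<zero>" .
    obtain a b c where abc: "a \<in> carrier R" "b \<in> carrier R" "c \<in> carrier R"
      and eq: "?p = t \<otimes> c \<ominus> u \<otimes> b" "?q = u \<otimes> a \<ominus> s \<otimes> c" "?r = s \<otimes> b \<ominus> t \<otimes> a"
      by (rule koszul1[OF cl rel])
    have m1: "s \<otimes> b \<ominus> t \<otimes> a \<in> J" and m3: "t \<otimes> c \<ominus> u \<otimes> b \<in> J"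
      using eq inJ pqr p' by metis+
    have "s \<otimes> c \<ominus> u \<otimes> a = (\<ominus> \<one>) \<otimes> ?q" unfolding eq(2) using abc stu by algebra
    then have m2: "s \<otimes> c \<ominus> u \<otimes> a \<in> J" using ideal_mult[OF J _ inJ[OF pqr(2) p'(2)]] by simp
    \<comment> \<open>The entries of the relation are the minors of \<open>(a, b, c)\<close>; as
      they lie in \<open>J\<close>, the vector is a cycle modulo \<open>J\<close> and hence a
      boundary.\<close>
    obtain z where z: "z \<in> carrier R" "a \<ominus> s \<otimes> z \<in> J" "b \<ominus> t \<otimes> z \<in> J" "c \<ominus> u \<otimes> z \<in> J"
      by (rule koszul2_mod[OF J x y abc m1 m2 m3])
    obtain a' where a': "a' \<in> carrier R" "(a \<ominus> s \<otimes> z) \<ominus> a' \<otimes> f \<in> J'" by (rule add_PIdlE[OF z(2)[unfolded JJ'] J'(1) fc])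
    obtain b' where b': "b' \<in> carrier R" "(b \<ominus> t \<otimes> z) \<ominus> b' \<otimes> f \<in> J'" by (rule add_PIdlE[OF z(3)[unfolded JJ'] J'(1) fc])
    obtain c' where c': "c' \<in> carrier R" "(c \<ominus> u \<otimes> z) \<ominus> c' \<otimes> f \<in> J'" by (rule add_PIdlE[OF z(4)[unfolded JJ'] J'(1) fc])
    \<comment> \<open>Here \<open>(a', b', c')\<close> are the coefficients of \<open>f\<close> in
      what remains of \<open>(a, b, c)\<close>. The part along \<open>(s, t, u)\<close> drops out of
      the cross product and the rest lies in \<open>J'\<close>, so the difference multiplies
      \<open>f\<close> into \<open>J'\<close>.\<close>
    have inL: "h \<ominus> (d1 \<otimes> g2 \<ominus> d2 \<otimes> h2) \<in> ?L"
      if "d1 \<in> carrier R" "d2 \<in> carrier R" "g1 \<in> carrier R" "h1 \<in> carrier R" "g2 \<in> carrier R" "h2 \<in> carrier R"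
        "h \<in> carrier R" "e \<in> J'" "h \<otimes> f \<ominus> e = d1 \<otimes> g1 \<ominus> d2 \<otimes> h1"
        and gh: "(g1 \<ominus> d2 \<otimes> z) \<ominus> g2 \<otimes> f \<in> J'" "(h1 \<ominus> d1 \<otimes> z) \<ominus> h2 \<otimes> f \<in> J'" for d1 d2 g1 h1 g2 h2 h e
    proof -
      have ec: "e \<in> carrier R" using ideal_carrier[OF J'(1) that(8)] .
      have "(h \<ominus> (d1 \<otimes> g2 \<ominus> d2 \<otimes> h2)) \<otimes> f = e \<oplus> (h \<otimes> f \<ominus> e) \<ominus> (d1 \<otimes> g2 \<ominus> d2 \<otimes> h2) \<otimes> f"
        using that(1-7) ec fc by algebra
      also have "\<dots> = \<one> \<otimes> e \<oplus> d1 \<otimes> ((g1 \<ominus> d2 \<otimes> z) \<ominus> g2 \<otimes> f) \<oplus> (\<ominus> d2) \<otimes> ((h1 \<ominus> d1 \<otimes> z) \<ominus> h2 \<otimes> f)"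
        unfolding that(9) using that(1-7) ec fc z(1) by algebra
      also have "\<dots> \<in> J'" by (rule ideal_comb3[OF J'(1)]) (use that in auto)
      finally show ?thesis using that by (simp add: ideal_colon_singleton)
    qed
    have 1: "p \<ominus> (t \<otimes> c' \<ominus> u \<otimes> b') \<in> ?L"
      by (rule inL[OF stu(2,3) abc(3,2) c'(1) b'(1) pqr(1) p'(1) eq(1) c'(2) b'(2)])
    have 2: "q \<ominus> (u \<otimes> a' \<ominus> s \<otimes> c') \<in> ?L"
      by (rule inL[OF stu(3,1) abc(1,3) a'(1) c'(1) pqr(2) p'(2) eq(2) a'(2) c'(2)])
    have 3: "r \<ominus> (s \<otimes> b' \<ominus> t \<otimes> a') \<in> ?L"
      by (rule inL[OF stu(1,2) abc(2,1) b'(1) a'(1) pqr(3) p'(3) eq(3) b'(2) a'(2)])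
    have "g = s \<otimes> (p \<ominus> (t \<otimes> c' \<ominus> u \<otimes> b')) \<oplus> t \<otimes> (q \<ominus> (u \<otimes> a' \<ominus> s \<otimes> c')) \<oplus> u \<otimes> (r \<ominus> (s \<otimes> b' \<ominus> t \<otimes> a'))"
      unfolding pqr(4) using pqr(1-3) a'(1) b'(1) c'(1) stu by algebra
    also have "\<dots> \<in> K" by (intro ideal_add[OF K(1)] K(2) s_in_m t_in_m u_in_m 1 2 3)
    finally show "g \<in> K" .
  qed
  then have "J' \<subseteq> {\<zero>}" using ideal_colon_superset[OF J'(1), of "{f}"] fc by auto
  then have "J' = {\<zero>}" using ideal_zero[OF J'(1)] by blast
  then have "x \<in> J \<longleftrightarrow> x \<in> PIdl f" for x
    unfolding JJ' in_add_PIdl_iff using fc by (auto simp: cgenideal_def)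
  then have "J = PIdl f" by blast
  then show ?thesis using fc by blast
qed

text \<open>Some product \<open>a \<otimes> b\<close> is a unit times \<open>f\<close>, since
  otherwise \<open>f\<close> would be a multiple of itself by an element of \<open>m\<close>. For
  \<open>z \<in> B\<close> the product \<open>a \<otimes> z\<close> is then a multiple of
  \<open>a \<otimes> b\<close>, and cancelling \<open>a\<close> shows that \<open>b\<close>
  generates \<open>B\<close>.\<close>

lemma principal_factor:
  assumes A: "ideal A R" and B: "ideal B R" and f: "f \<in> carrier R" "f \<noteq> \<zero>" "ideal_prod R A B = PIdl f"
  obtains b where "b \<in> carrier R" "B = PIdl b"
proof -
  have "\<exists>a\<in>A. \<exists>b\<in>B. \<exists>r\<in>carrier R - m. a \<otimes> b = r \<otimes> f"
  proof (rule ccontr)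
    assume neg: "\<not> ?thesis"
    have "\<exists>r\<in>m. y = r \<otimes> f" if "y \<in> ideal_prod R A B" for y
      using that
    proof (induction y rule: ideal_prod.induct)
      case (prod a b)
      then have "a \<otimes> b \<in> PIdl f" using ideal_prod.prod[of a A b B R] f(3) by auto
      then obtain r where "r \<in> carrier R" "a \<otimes> b = r \<otimes> f" by (auto simp: cgenideal_def)
      then show ?case using neg prod by blast
    next
      case (sum x y)
      then obtain r r' where "r \<in> m" "r' \<in> m" "x = r \<otimes> f" "y = r' \<otimes> f" by blast
      then have "x \<oplus> y = (r \<oplus> r') \<otimes> f" "r \<oplus> r' \<in> m"
        using f m_carrier ideal_add[OF m_ideal] by (auto simp: l_distr)
      then show ?case by blast
    qed
    moreover have "f \<in> ideal_prod R A B" unfolding f(3) by (rule cgenideal_self[OF f(1)])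
    ultimately obtain r where r: "r \<in> m" "f = r \<otimes> f" by blast
    have "\<one> \<otimes> f = r \<otimes> f" using r f by simp
    then have "\<one> = r" using m_rcancel[OF f(2,1)] m_carrier[OF r(1)] by blast
    then show False using r one_notin_m by blast
  qed
  then obtain a b r where a: "a \<in> A" "b \<in> B" "r \<in> carrier R" "r \<notin> m" "a \<otimes> b = r \<otimes> f" by blast
  have ac: "a \<in> carrier R" and bc: "b \<in> carrier R" using a A B ideal_carrier by auto
  obtain d where d: "d \<in> carrier R" "d \<otimes> r = \<one>" using unit_outside_m[OF a(3,4)] by blast
  have "f = (d \<otimes> r) \<otimes> f" using d f by simp
  also have "\<dots> = d \<otimes> (a \<otimes> b)" unfolding a(5) by (rule m_assoc[OF d(1) a(3) f(1)])
  finally have fab: "f = d \<otimes> (a \<otimes> b)" .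
  then have a0: "a \<noteq> \<zero>" using f(2) d bc by auto
  have "B \<subseteq> PIdl b"
  proof
    fix z assume z: "z \<in> B"
    then have zc: "z \<in> carrier R" using B ideal_carrier by blast
    have "a \<otimes> z \<in> PIdl f" using ideal_prod.prod[OF a(1) z, of R] f(3) by simp
    then obtain k where k: "k \<in> carrier R" "a \<otimes> z = k \<otimes> f" by (auto simp: cgenideal_def)
    have "a \<otimes> z = a \<otimes> ((k \<otimes> d) \<otimes> b)" unfolding k(2) fab using k(1) d(1) ac bc by algebra
    then have "z = (k \<otimes> d) \<otimes> b" using m_lcancel[OF a0 ac zc, of "(k \<otimes> d) \<otimes> b"] k d bc by auto
    then show "z \<in> PIdl b" using k d by (auto simp: cgenideal_def)
  qed
  moreover have "PIdl b \<subseteq> B" using cgenideal_minimal[OF B a(2)] .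
  ultimately show ?thesis using that bc by blast
qed

end

section \<open>Depth of the powers of an ideal\<close>

context cring
begin

lemma add_PIdl_subset:
  "ideal K R \<Longrightarrow> J \<subseteq> K \<Longrightarrow> x \<in> K \<Longrightarrow> J <+>\<^bsub>R\<^esub> PIdl x \<subseteq> K"
  by (auto simp: in_add_PIdl_iff subset_iff intro!: ideal_add ideal_mult)

lemma set_add_assoc_ideal:
  assumes "ideal A R" "ideal B R" "ideal C R"
  shows "(A <+>\<^bsub>R\<^esub> B) <+>\<^bsub>R\<^esub> C = A <+>\<^bsub>R\<^esub> (B <+>\<^bsub>R\<^esub> C)"
  using assms by (intro add.set_mult_assoc[folded set_add_defs]) (auto intro: ideal_carrier)

lemma genideal_insert:
  assumes "x \<in> carrier R" "S \<subseteq> carrier R"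
  shows "Idl (insert x S) = PIdl x <+>\<^bsub>R\<^esub> Idl S"
proof -
  have i: "ideal (PIdl x) R" "ideal (Idl S) R" "ideal (Idl (insert x S)) R"
    using assms by (auto intro: cgenideal_ideal genideal_ideal)
  have sub: "insert x S \<subseteq> Idl (insert x S)" by (rule genideal_self) (use assms in auto)
  have "Idl (PIdl x \<union> Idl S) = Idl (insert x S)"
  proof
    have "PIdl x \<subseteq> Idl (insert x S)" using sub by (intro cgenideal_minimal i) auto
    moreover have "Idl S \<subseteq> Idl (insert x S)" using sub by (intro genideal_minimal i) auto
    ultimately show "Idl (PIdl x \<union> Idl S) \<subseteq> Idl (insert x S)" by (intro genideal_minimal i) auto
    have "PIdl x \<union> Idl S \<subseteq> carrier R" using i ideal_carrier by blast
    moreover from this have "PIdl x \<union> Idl S \<subseteq> Idl (PIdl x \<union> Idl S)" by (rule genideal_self)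
    ultimately show "Idl (insert x S) \<subseteq> Idl (PIdl x \<union> Idl S)"
      using cgenideal_self[OF assms(1)] genideal_self[OF assms(2)]
      by (intro genideal_minimal genideal_ideal) auto
  qed
  then show ?thesis using union_genideal[OF i(1,2)] by simp
qed

lemma add_genideal_empty:
  assumes "ideal J R"
  shows "J <+>\<^bsub>R\<^esub> Idl {} = J"
proof -
  have "Idl {} = {\<zero>}"
    using genideal_minimal[OF zeroideal, of "{}"] ideal_zero[OF genideal_ideal, of "{}"] by auto
  then show ?thesis using assms ideal_carrier by (auto simp: set_add_def')
qed

lemma quot_regular_seq_Nil:
  "ideal J R \<Longrightarrow> quot_regular_seq R m J [] \<longleftrightarrow> J \<noteq> carrier R"
  by (simp add: quot_regular_seq_def add_genideal_empty)

text \<open>Absorbing the head of the list into the ideal replaces the prefixes of the definition by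
  recursion, which allows a regular sequence to be consumed one element at a time.\<close>

lemma quot_regular_seq_Cons:
  assumes J: "ideal J R" and m: "m \<subseteq> carrier R"
  shows "quot_regular_seq R m J (x # xs) \<longleftrightarrow>
    x \<in> m \<and> nonzerodivisor_mod R J x \<and> quot_regular_seq R m (J <+>\<^bsub>R\<^esub> PIdl x) xs"
proof (cases "x \<in> m \<and> set xs \<subseteq> m")
  case False
  then show ?thesis by (auto simp: quot_regular_seq_def)
next
  case True
  then have xc: "x \<in> carrier R" and xsc: "set xs \<subseteq> carrier R" using m by auto
  have eq: "J <+>\<^bsub>R\<^esub> Idl (insert x S) = (J <+>\<^bsub>R\<^esub> PIdl x) <+>\<^bsub>R\<^esub> Idl S" if "S \<subseteq> carrier R" for S
    using that xc J by (simp add: genideal_insert set_add_assoc_ideal cgenideal_ideal genideal_ideal)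
  have "set (take i xs) \<subseteq> carrier R" for i using set_take_subset xsc by fast
  then show ?thesis using True xsc
    by (simp add: quot_regular_seq_def All_less_Suc2 eq add_genideal_empty[OF J] nonzerodivisor_mod_def)
qed

lemma ideal_pow_ideal: "ideal I R \<Longrightarrow> ideal (ideal_pow R I n) R"
  by (induction n) (auto intro: oneideal ideal_prod_is_ideal)

end

context noetherian_local_ring
begin

lemma depth_quot_ge:
  assumes "quot_regular_seq R m J xs"
  shows "enat (length xs) \<le> depth_quot R m J"
  using assms by (auto simp: depth_quot_def intro!: Sup_upper)

end

section \<open>Comparison of successive powers\<close>

lemma (in local_ring_three_generators) ideal_pow_nonzero:
  assumes I: "ideal I R" "I \<noteq> {\<zero>}"
  shows "ideal_pow R I n \<noteq> {\<zero>}"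
proof -
  obtain a where a: "a \<in> I" "a \<noteq> \<zero>" using I ideal_zero by blast
  have ac: "a \<in> carrier R" using a I ideal_carrier by blast
  have "\<exists>b\<in>ideal_pow R I n. b \<noteq> \<zero>"
  proof (induction n)
    case 0
    show ?case by (rule bexI[of _ \<one>]) auto
  next
    case (Suc n)
    then obtain b where b: "b \<in> ideal_pow R I n" "b \<noteq> \<zero>" by blast
    have "b \<in> carrier R" using b ideal_pow_ideal[OF I(1)] ideal_carrier by blast
    then have "a \<otimes> b \<noteq> \<zero>" using integral[of a b] a b ac by blast
    moreover have "a \<otimes> b \<in> ideal_pow R I (Suc n)" using a b by (auto intro: ideal_prod.prod)
    ultimately show ?case by blast
  qed
  then show ?thesis by blast
qed

lemma (in local_ring_three_generators) depth_quot_ideal_pow_Suc_le: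
  assumes I: "ideal I R"
    and colon: "\<And>n. n \<ge> 1 \<Longrightarrow> ideal_colon R (ideal_pow R I (Suc n)) I = ideal_pow R I n"
    and n: "n \<ge> 1"
  shows "depth_quot R m (ideal_pow R I (Suc n)) \<le> depth_quot R m (ideal_pow R I n)"
proof (cases "ideal_pow R I n = carrier R")
  \<comment> \<open>Here \<open>R/I^n\<close> is the zero module, whose depth is infinite by
    convention.\<close>
  case True
  then show ?thesis by (simp add: depth_quot_def)
next
  case False
  let ?A = "ideal_pow R I n" and ?B = "ideal_pow R I (Suc n)"
  have A: "ideal ?A R" and B: "ideal ?B R" by (rule ideal_pow_ideal[OF I])+
  have "?B \<subseteq> ?A" using ideal_prod_inter[OF I A] by simp
  then have BA: "?B \<noteq> carrier R" using False ideal_carrier[OF A] by blast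
  have Am: "?A \<subseteq> m" by (rule proper_ideal_subset[OF A False])
  have Bm: "?B \<subseteq> m" by (rule proper_ideal_subset[OF B BA])
  have mc: "m \<subseteq> carrier R" using m_carrier by blast
  have I0: "I \<noteq> {\<zero>}"
  proof
    \<comment> \<open>For the zero ideal \<open>I^2 : I\<close> is the whole ring, so the hypothesis
      at \<open>n = 1\<close> would put \<open>\<one>\<close> into \<open>I\<close>.\<close>
    assume I0: "I = {\<zero>}"
    have "\<zero> \<in> ideal_pow R I (Suc 1)" by (rule ideal_zero[OF ideal_pow_ideal[OF I]])
    then have "\<one> \<in> ideal_colon R (ideal_pow R I (Suc 1)) I" by (simp add: ideal_colon_def I0)
    then have "\<one> \<in> ideal_pow R I 1" using colon[of 1] by simp
    also have "ideal_pow R I 1 \<subseteq> I" using ideal_prod_inter[OF I oneideal] by auto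
    finally show False using I0 by simp
  qed
  note seq_A = quot_regular_seq_Cons[OF A mc] quot_regular_seq_Nil[OF A]
  have "enat (length xs) \<le> depth_quot R m ?A" if xs: "quot_regular_seq R m ?B xs" for xs
  proof (cases xs)
    case Nil
    then show ?thesis by (simp add: enat_0)
  next
    case (Cons x xs')
    then have x: "x \<in> m" "nonzerodivisor_mod R ?B x"
      and xs': "quot_regular_seq R m (?B <+>\<^bsub>R\<^esub> PIdl x) xs'"
      using xs quot_regular_seq_Cons[OF B mc] by auto
    have xc: "x \<in> carrier R" using m_carrier[OF x(1)] .
    have Bx: "ideal (?B <+>\<^bsub>R\<^esub> PIdl x) R" by (rule add_PIdl_ideal[OF B xc])
    show ?thesis
    proof (cases xs')
      case Nil
      have "ideal_colon R ?A m \<subseteq> ?A"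
      proof
        fix z assume z: "z \<in> ideal_colon R ?A m"
        then have zc: "z \<in> carrier R" by (simp add: ideal_colon_def)
        have zx: "z \<otimes> x \<in> ?A" using z x(1) by (simp add: ideal_colon_def)
        \<comment> \<open>Multiplying \<open>z \<otimes> x \<in> I^n\<close> by \<open>a\<close>
          lands in \<open>I^(n+1)\<close>, where the regular element \<open>x\<close>
          cancels.\<close>
        have "z \<otimes> a \<in> ?B" if a: "a \<in> I" for a
        proof -
          have ac: "a \<in> carrier R" using ideal_carrier[OF I a] .
          have "a \<otimes> (z \<otimes> x) \<in> ?B" using ideal_prod.prod[OF a zx] by simp
          also have "a \<otimes> (z \<otimes> x) = x \<otimes> (z \<otimes> a)" using ac zc xc by algebra
          finally show ?thesis using nonzerodivisor_modD[OF x(2)] zc ac by blast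
        qed
        then have "z \<in> ideal_colon R ?B I" using zc by (simp add: ideal_colon_def)
        then show "z \<in> ?A" using colon[OF n] by simp
      qed
      then obtain y where y: "y \<in> m" "nonzerodivisor_mod R ?A y"
        using ex_nonzerodivisor_mod[OF A m_ideal] by blast
      have yc: "y \<in> carrier R" using m_carrier[OF y(1)] .
      have "?A <+>\<^bsub>R\<^esub> PIdl y \<subseteq> m"  by (rule add_PIdl_subset[OF m_ideal Am y(1)])
      then have "quot_regular_seq R m ?A [y]"
        using y one_notin_m by (auto simp: seq_A quot_regular_seq_Nil[OF add_PIdl_ideal[OF A yc]])
      then show ?thesis using depth_quot_ge Cons Nil by fastforce
    next
      case (Cons y xs'')
      then have y: "y \<in> m" "nonzerodivisor_mod R (?B <+>\<^bsub>R\<^esub> PIdl x) y"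
        and xs'': "quot_regular_seq R m ((?B <+>\<^bsub>R\<^esub> PIdl x) <+>\<^bsub>R\<^esub> PIdl y) xs''"
        using xs' quot_regular_seq_Cons[OF Bx mc] by auto
      have yc: "y \<in> carrier R" using m_carrier[OF y(1)] .
      note Bxy = add_PIdl_ideal[OF Bx yc]
      have B0: "?B \<noteq> {\<zero>}" by (rule ideal_pow_nonzero[OF I I0])
      have "xs'' = []"
      proof (cases xs'')
        case (Cons v ys)
        then have "v \<in> m" "nonzerodivisor_mod R ((?B <+>\<^bsub>R\<^esub> PIdl x) <+>\<^bsub>R\<^esub> PIdl y) v"
          using xs'' quot_regular_seq_Cons[OF Bxy mc] by auto
        then have "?B = {\<zero>}" by (rule regular_triple_zero[OF B Bm x y])
        then show ?thesis using B0 by blast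
      qed
      obtain f where f: "f \<in> carrier R" "?B = PIdl f" using regular_pair_principal[OF B x y] by blast
      have f0: "f \<noteq> \<zero>"
      proof
        assume "f = \<zero>"
        then have "?B \<subseteq> {\<zero>}" unfolding f(2) by (auto simp: cgenideal_def)
        then show False using B0 ideal_zero[OF B] by blast
      qed
      obtain b where b: "b \<in> carrier R" "?A = PIdl b"
        by (rule principal_factor[OF I A f(1) f0]) (use f(2) in simp)
      have b0: "b \<noteq> \<zero>"
      proof
        assume "b = \<zero>"
        then have "?A \<subseteq> {\<zero>}" unfolding b(2) by (auto simp: cgenideal_def)
        then show False using ideal_pow_nonzero[OF I I0, of n] ideal_zero[OF A] by blast
      qed
      obtain x' y' where x': "x' \<in> m" "nonzerodivisor_mod R ?A x'"
        and y': "y' \<in> m" "nonzerodivisor_mod R (?A <+>\<^bsub>R\<^esub> PIdl x') y'"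
        unfolding b(2) by (rule principal_regular_pair[OF b(1) b0])
      have xc': "x' \<in> carrier R" and yc': "y' \<in> carrier R" using m_carrier x' y' by auto
      note Ax = add_PIdl_ideal[OF A xc']
      note Axy = add_PIdl_ideal[OF Ax yc']
      have "(?A <+>\<^bsub>R\<^esub> PIdl x') <+>\<^bsub>R\<^esub> PIdl y' \<subseteq> m"
        by (intro add_PIdl_subset m_ideal Am x'(1) y'(1))
      then have "quot_regular_seq R m ?A [x', y']"
        using x' y' one_notin_m
        by (auto simp: seq_A quot_regular_seq_Cons[OF Ax mc] quot_regular_seq_Nil[OF Axy])
      then show ?thesis using depth_quot_ge \<open>xs = x # xs'\<close> \<open>xs' = y # xs''\<close> \<open>xs'' = []\<close> by fastforce
    qed
  qed
  then have "Sup {enat (length xs) | xs. quot_regular_seq R m ?B xs} \<le> depth_quot R m ?A"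
    by (intro Sup_least) auto
  then show ?thesis using BA by (simp add: depth_quot_def)
qed

section \<open>Generators and a chain of primes from regularity\<close>

lemma regular_local_ring_three_generators:
  assumes "regular_local_ring R m" "krull_dim R = 3"
  obtains s t u P0 P1 P2 where "local_ring_three_generators R m s t u P0 P1 P2"
proof -
  have "noetherian_ring R" "cring R" "maximalideal m R" "\<And>J. maximalideal J R \<Longrightarrow> J = m"
    using assms(1) by (auto simp: regular_local_ring_def local_ring_def)
  then interpret noetherian_local_ring R m
    by (intro noetherian_local_ring.intro noetherian_cring.intro noetherian_local_ring_axioms.intro)
  obtain S where S: "S \<subseteq> carrier R" "m = genideal R S" "enat (card S) = 3"
    using assms by (auto simp: regular_local_ring_def)
  have "card S = 3" using S(3) by (simp add: numeral_eq_enat)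
  then obtain s t u where stu: "S = {s, t, u}" by (auto simp: card_3_iff)
  have c: "s \<in> carrier R" "t \<in> carrier R" "u \<in> carrier R" using S(1) stu by auto
  have meq: "m = (PIdl\<^bsub>R\<^esub> s <+>\<^bsub>R\<^esub> PIdl\<^bsub>R\<^esub> t) <+>\<^bsub>R\<^esub> PIdl\<^bsub>R\<^esub> u"
    using S(2) c by (simp add: stu genideal_insert add_genideal_empty cgenideal_ideal set_add_assoc_ideal)
  have m_eq: "m = {s \<otimes>\<^bsub>R\<^esub> a \<oplus>\<^bsub>R\<^esub> t \<otimes>\<^bsub>R\<^esub> b \<oplus>\<^bsub>R\<^esub> u \<otimes>\<^bsub>R\<^esub> d | a b d. a \<in> carrier R \<and> b \<in> carrier R \<and> d \<in> carrier R}"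
  proof -
    have "x \<in> m \<longleftrightarrow> (\<exists>a\<in>carrier R. \<exists>b\<in>carrier R. \<exists>d\<in>carrier R.
      x = s \<otimes>\<^bsub>R\<^esub> a \<oplus>\<^bsub>R\<^esub> t \<otimes>\<^bsub>R\<^esub> b \<oplus>\<^bsub>R\<^esub> u \<otimes>\<^bsub>R\<^esub> d)" for x
    proof -
      have eq: "a \<otimes>\<^bsub>R\<^esub> s \<oplus>\<^bsub>R\<^esub> b \<otimes>\<^bsub>R\<^esub> t \<oplus>\<^bsub>R\<^esub> d \<otimes>\<^bsub>R\<^esub> u = s \<otimes>\<^bsub>R\<^esub> a \<oplus>\<^bsub>R\<^esub> t \<otimes>\<^bsub>R\<^esub> b \<oplus>\<^bsub>R\<^esub> u \<otimes>\<^bsub>R\<^esub> d"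
        if "a \<in> carrier R" "b \<in> carrier R" "d \<in> carrier R" for a b d
        using that c by algebra
      have "x \<in> m \<longleftrightarrow> (\<exists>a\<in>carrier R. \<exists>b\<in>carrier R. \<exists>d\<in>carrier R.
        x = a \<otimes>\<^bsub>R\<^esub> s \<oplus>\<^bsub>R\<^esub> b \<otimes>\<^bsub>R\<^esub> t \<oplus>\<^bsub>R\<^esub> d \<otimes>\<^bsub>R\<^esub> u)"
        unfolding meq in_add_PIdl_iff[of _ "PIdl\<^bsub>R\<^esub> s <+>\<^bsub>R\<^esub> PIdl\<^bsub>R\<^esub> t"] Bex_def in_two_PIdl_iff by blast
      then show ?thesis by (simp add: eq cong: bex_cong)
    qed
    then show ?thesis by blast
  qed
  \<comment> \<open>A strict lower bound on the supremum is met by an actual chain, whose length is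
    then at least three.\<close>
  have "2 < krull_dim R" unfolding assms(2) by simp
  then obtain n where n: "2 < enat n"
    and "\<exists>P :: nat \<Rightarrow> 'a set. (\<forall>i\<le>n. primeideal (P i) R) \<and> (\<forall>i<n. P i \<subset> P (Suc i))"
    unfolding krull_dim_def less_Sup_iff by blast
  then obtain P :: "nat \<Rightarrow> 'a set" where
    P: "\<And>i. i \<le> n \<Longrightarrow> primeideal (P i) R" "\<And>i. i < n \<Longrightarrow> P i \<subset> P (Suc i)"
    by metis
  have n3: "3 \<le> n" using n by (simp add: numeral_eq_enat)
  \<comment> \<open>\<open>P 3\<close> serves to make \<open>P 2\<close> strictly smaller than
    \<open>m\<close>, and \<open>m\<close> takes its place at the top of the chain.\<close>
  have "P 3 \<subseteq> m" using primeideal.axioms(1)[OF P(1)[of 3]] primeideal.I_notcarr[OF P(1)[of 3]] n3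
    by (intro proper_ideal_subset) auto
  moreover have "P 2 \<subset> P 3" using P(2)[of 2] n3 by (simp add: eval_nat_numeral)
  ultimately have chain2: "P 2 \<subset> m" by blast
  have chain: "P 0 \<subset> P 1" "P 1 \<subset> P 2" using P(2)[of 1] P(2)[of 0] n3 by (simp_all add: eval_nat_numeral)
  have primes: "primeideal (P 0) R" "primeideal (P 1) R" "primeideal (P 2) R" using P(1) n3 by auto
  have "local_ring_three_generators R m s t u (P 0) (P 1) (P 2)"
    by (intro local_ring_three_generators.intro local_ring_three_generators_axioms.intro
      noetherian_local_ring_axioms c m_eq primes chain chain2)
  then show ?thesis by (rule that)
qed

theorem theorem3p1:
  fixes R :: "('a, 'b) ring_scheme" and m I :: "'a set"
  assumes "regular_local_ring R m"
    and "krull_dim R = 3"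
    and "ideal I R"
    and "\<forall>n\<ge>1. ideal_colon R (ideal_pow R I (Suc n)) I = ideal_pow R I n"
  shows "\<forall>n\<ge>1. depth_quot R m (ideal_pow R I (Suc n)) \<le> depth_quot R m (ideal_pow R I n)"
proof -
  obtain s t u P0 P1 P2 where "local_ring_three_generators R m s t u P0 P1 P2"
    by (rule regular_local_ring_three_generators[OF assms(1,2)])
  then show ?thesis
    using local_ring_three_generators.depth_quot_ideal_pow_Suc_le[of R m s t u P0 P1 P2 I] assms(3,4) by blast
qed

end
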